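(* Let $\mathcal H$ be a real separable Hilbert space, $K\ge 1$ an integer, and let $\gamma_1,\ldots,\gamma_K$ be an arbitrary finite collection of centred (mean-zero) Gaussian measures on $\mathcal H$. Then there exists an optimal multicoupling $\pi^*$ of $\{\gamma_1,\ldots,\gamma_K\}$ that is manifested by deterministic transport maps $\mathbf t_1,\ldots,\mathbf t_K:\mathcal H\to\mathcal H$ which are bounded, self-adjoint, non-negative linear operators satisfying $\|\mathbf t_j\|_\infty\le K$ for all $j=1,\ldots,K$. That is, there exist such operators $\mathbf t_j$ and an $\mathcal H$-valued random element $Z$ such that the law of $(\mathbf t_1 Z,\ldots,\mathbf t_K Z)$ is an optimal multicoupling of $\gamma_1,\ldots,\gamma_K$.
   Context: A centred Gaussian measure $N(0,\Sigma)$ on $\mathcal H$ is determined by its covariance operator $\Sigma$, a self-adjoint, non-negative, trace-class operator on $\mathcal H$. A multicoupling of probability measures $\gamma_1,\ldots,\gamma_K$ on $\mathcal H$ is a Borel probability measure $\pi$ on $\mathcal H^K$ whose $j$-th marginal is $\gamma_j$ for every $j$. An optimal multicoupling is a multicoupling $\pi^*$ minimising $$F(\pi)=\frac{1}{2K^2}\sum_{i,j=1}^K\int_{\mathcal H^K}\|x_i-x_j\|^2\,\pi(dx_1,\ldots,dx_K)$$ over all multicouplings $\pi$. A multicoupling $\pi$ is said to be manifested by deterministic transport maps $\mathbf t_j:\mathcal H\to\mathcal H$ if there is a random element $Z$ of $\mathcal H$ such that $(\mathbf t_1(Z),\ldots,\mathbf t_K(Z))$ has law $\pi$. An operator $A$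 is non-negative if it is self-adjoint and $\langle Au,u\rangle\ge 0$ for all $u$; $\|A\|_\infty=\sup_{\|h\|=1}\|Ah\|$ is the operator norm. *)

theory Defs
  imports "HOL-Probability.Probability"
begin

definition centred_gaussian_real :: "real measure \<Rightarrow> bool" where
  "centred_gaussian_real \<nu> \<longleftrightarrow>
     \<nu> = return borel 0 \<or> (\<exists>\<sigma>>0. \<nu> = density lborel (normal_density 0 \<sigma>))"

definition centred_gaussian :: "'a::{real_inner, polish_space} measure \<Rightarrow> bool" where
  "centred_gaussian \<mu> \<longleftrightarrow> prob_space \<mu> \<and> sets \<mu> = sets borel \<and>
     (\<forall>h. centred_gaussian_real (distr \<mu> borel (\<lambda>x. inner h x)))"

definition prodK :: "nat \<Rightarrow> (nat \<Rightarrow> 'a::topological_space) measure" where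
  "prodK K = PiM {..<K} (\<lambda>_. borel)"

definition multicoupling :: "nat \<Rightarrow> (nat \<Rightarrow> 'a::topological_space measure) \<Rightarrow> (nat \<Rightarrow> 'a) measure \<Rightarrow> bool" where
  "multicoupling K \<gamma> \<pi> \<longleftrightarrow> prob_space \<pi> \<and> sets \<pi> = sets (prodK K) \<and>
     (\<forall>j<K. distr \<pi> borel (\<lambda>x. x j) = \<gamma> j)"

definition mc_cost :: "nat \<Rightarrow> (nat \<Rightarrow> 'a::real_normed_vector) measure \<Rightarrow> ennreal" where
  "mc_cost K \<pi> = ennreal (1 / (2 * (real K)\<^sup>2)) *
     (\<Sum>i<K. \<Sum>j<K. \<integral>\<^sup>+ x. ennreal ((norm (x i - x j))\<^sup>2) \<partial>\<pi>)"

definition optimal_multicoupling :: "nat \<Rightarrow> (nat \<Rightarrow> 'a::real_normed_vector measure) \<Rightarrow> (nat \<Rightarrow> 'a) measure \<Rightarrow> bool" where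
  "optimal_multicoupling K \<gamma> \<pi> \<longleftrightarrow> multicoupling K \<gamma> \<pi> \<and>
     (\<forall>\<pi>'. multicoupling K \<gamma> \<pi>' \<longrightarrow> mc_cost K \<pi> \<le> mc_cost K \<pi>')"

end

theory Submission
  imports Defs
begin

text \<open>
  Up to a constant, the cost of a multicoupling is minus the trace of the covariance of
  \<open>X\<^sub>1 + \<dots> + X\<^sub>K\<close>, so only the joint covariance matters. Joint covariances with the
  prescribed diagonal blocks form a compact set, hence there is an optimal one, and it is realised
  by a Gaussian vector \<open>X\<^sub>j = A\<^sub>j \<xi>\<close> with \<open>A\<^sub>j\<close> Hilbert--Schmidt and \<open>\<xi>\<close> white noise.
  Put \<open>B = A\<^sub>1 + \<dots> + A\<^sub>K\<close>. Replacing one \<open>A\<^sub>j\<close> by \<open>A\<^sub>j U\<close> with \<open>U\<close> orthogonal keeps all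
  marginals; optimality against reflections and products of two reflections says that
  \<open>A\<^sub>j\<^sup>* (B - A\<^sub>j)\<close> is symmetric and non-negative. Therefore \<open>A\<^sub>j\<^sup>* B\<close> is symmetric and
  \<open>\<parallel>A\<^sub>j x\<parallel>\<^sup>2 \<le> \<langle>A\<^sub>j x, B x\<rangle>\<close>, and an extension argument in the style of Krein gives a
  self-adjoint \<open>t\<^sub>j\<close> with \<open>0 \<le> t\<^sub>j \<le> 1\<close> and \<open>t\<^sub>j B = A\<^sub>j\<close>. So \<open>X\<^sub>j = t\<^sub>j Z\<close> for
  \<open>Z = B \<xi>\<close>.
\<close>

section \<open>Orthonormal expansions and positive contractions\<close>

locale hilbert_basis =
  fixes e :: "nat \<Rightarrow> 'a::{real_inner, polish_space}"
  assumes orthogonal: "j \<noteq> k \<Longrightarrow> e j \<bullet> e k = 0"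
    and unit_or_zero: "e k \<noteq> 0 \<Longrightarrow> e k \<bullet> e k = 1"
    and expansion: "(\<lambda>k. (e k \<bullet> x) *\<^sub>R e k) sums x"

fun gram_schmidt :: "(nat \<Rightarrow> 'a::real_inner) \<Rightarrow> nat \<Rightarrow> 'a" where
  "gram_schmidt d n = sgn (d n - (\<Sum>k<n. (gram_schmidt d k \<bullet> d n) *\<^sub>R gram_schmidt d k))"

declare gram_schmidt.simps [simp del]

lemma gram_schmidt_unit_or_zero:
  "gram_schmidt d n \<noteq> 0 \<Longrightarrow> gram_schmidt d n \<bullet> gram_schmidt d n = 1"
proof -
  assume "gram_schmidt d n \<noteq> 0"
  moreover obtain w where "gram_schmidt d n = sgn w" using gram_schmidt.simps by blast
  ultimately show ?thesis by (simp add: dot_square_norm norm_sgn sgn_zero_iff)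
qed

lemma gram_schmidt_orthogonal_less: "j < n \<Longrightarrow> gram_schmidt d j \<bullet> gram_schmidt d n = 0"
proof (induction n arbitrary: j rule: less_induct)
  case (less n)
  let ?g = "gram_schmidt d"
  have orth: "?g j \<bullet> ?g k = 0" if "k < n" "k \<noteq> j" for k
    using less.IH[of j k] less.IH[of k j] that less.prems
    by (metis inner_commute linorder_neqE_nat)
  have "?g j \<bullet> (\<Sum>k<n. (?g k \<bullet> d n) *\<^sub>R ?g k) = (\<Sum>k<n. (?g k \<bullet> d n) * (?g j \<bullet> ?g k))"
    by (simp add: inner_sum_right)
  also have "\<dots> = (\<Sum>k\<in>{j}. (?g k \<bullet> d n) * (?g j \<bullet> ?g k))"
    by (rule sum.mono_neutral_right) (use less.prems orth in auto)
  also have "\<dots> = ?g j \<bullet> d n"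
    using gram_schmidt_unit_or_zero[of d j] by (cases "?g j = 0") auto
  finally show ?case
    by (subst gram_schmidt.simps[of d n]) (simp add: sgn_div_norm inner_diff_right)
qed

lemma gram_schmidt_orthogonal: "j \<noteq> k \<Longrightarrow> gram_schmidt d j \<bullet> gram_schmidt d k = 0"
  using gram_schmidt_orthogonal_less[of j k d] gram_schmidt_orthogonal_less[of k j d]
  by (metis inner_commute linorder_neqE_nat)

lemma gram_schmidt_partial_expansion:
  assumes "m < n"
  shows "(\<Sum>k<n. (gram_schmidt d k \<bullet> d m) *\<^sub>R gram_schmidt d k) = d m"
proof -
  let ?g = "gram_schmidt d"
  let ?r = "d m - (\<Sum>k<m. (?g k \<bullet> d m) *\<^sub>R ?g k)"
  have r: "?r = norm ?r *\<^sub>R ?g m"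
    by (subst gram_schmidt.simps[of d m]) (cases "?r = 0", auto simp: sgn_div_norm)
  have perp: "?g k \<bullet> d m = 0" if "k > m" for k
  proof -
    have "?g k \<bullet> ?r = 0"
      by (subst r) (use that gram_schmidt_orthogonal[of k m d] in simp)
    moreover have "?g k \<bullet> (\<Sum>k<m. (?g k \<bullet> d m) *\<^sub>R ?g k) = 0"
      using that gram_schmidt_orthogonal[of k _ d] by (auto simp: inner_sum_right intro!: sum.neutral)
    ultimately show ?thesis by (simp add: inner_diff_right)
  qed
  have "?g m \<bullet> (\<Sum>k<m. (?g k \<bullet> d m) *\<^sub>R ?g k) = 0"
    using gram_schmidt_orthogonal[of m _ d] by (auto simp: inner_sum_right intro!: sum.neutral)
  then have "?g m \<bullet> d m = ?g m \<bullet> ?r" by (simp add: inner_diff_right)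
  also have "\<dots> = norm ?r * (?g m \<bullet> ?g m)" by (subst r) simp
  finally have "(?g m \<bullet> d m) *\<^sub>R ?g m = ?r"
    using r gram_schmidt_unit_or_zero[of d m] by (cases "?g m = 0") auto
  then have "(\<Sum>k<Suc m. (?g k \<bullet> d m) *\<^sub>R ?g k) = d m" by simp
  moreover have "(\<Sum>k<n. (?g k \<bullet> d m) *\<^sub>R ?g k) = (\<Sum>k<Suc m. (?g k \<bullet> d m) *\<^sub>R ?g k)"
    by (rule sum.mono_neutral_right) (use assms perp in auto)
  ultimately show ?thesis by simp
qed

lemma bessel_remainder:
  fixes e :: "nat \<Rightarrow> 'a::real_inner"
  assumes "\<And>j k. j \<noteq> k \<Longrightarrow> e j \<bullet> e k = 0" "\<And>k. e k \<noteq> 0 \<Longrightarrow> e k \<bullet> e k = 1"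
  shows "norm (x - (\<Sum>k<n. (e k \<bullet> x) *\<^sub>R e k)) \<le> norm x"
proof -
  let ?Q = "\<Sum>k<n. (e k \<bullet> x) *\<^sub>R e k"
  have "?Q \<bullet> ?Q = (\<Sum>k<n. \<Sum>j<n. (e j \<bullet> x) * ((e k \<bullet> x) * (e k \<bullet> e j)))"
    by (subst inner_sum_left) (simp add: inner_sum_right sum_distrib_left)
  also have "\<dots> = (\<Sum>k<n. \<Sum>j\<in>{k}. (e j \<bullet> x) * ((e k \<bullet> x) * (e k \<bullet> e j)))"
    by (intro sum.cong sum.mono_neutral_right) (use assms in auto)
  also have "\<dots> = (\<Sum>k<n. (e k \<bullet> x)\<^sup>2)"
  proof (rule sum.cong[OF refl])
    fix k
    show "(\<Sum>j\<in>{k}. (e j \<bullet> x) * ((e k \<bullet> x) * (e k \<bullet> e j))) = (e k \<bullet> x)\<^sup>2"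
      using assms(2)[of k] by (cases "e k = 0") (auto simp: power2_eq_square)
  qed
  finally have Q: "?Q \<bullet> ?Q = (\<Sum>k<n. (e k \<bullet> x)\<^sup>2)" .
  have Qx: "?Q \<bullet> x = (\<Sum>k<n. (e k \<bullet> x)\<^sup>2)"
    by (simp add: inner_sum_left power2_eq_square)
  then have "x \<bullet> ?Q = (\<Sum>k<n. (e k \<bullet> x)\<^sup>2)"
    by (simp only: inner_commute)
  with Qx have "(x - ?Q) \<bullet> (x - ?Q) = x \<bullet> x - (\<Sum>k<n. (e k \<bullet> x)\<^sup>2)"
    using Q by (simp only: inner_diff_left inner_diff_right)
  also have "\<dots> \<le> x \<bullet> x" by (simp add: sum_nonneg)
  finally show ?thesis by (simp add: norm_le)
qed

lemma hilbert_basis_exists: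
  obtains e :: "nat \<Rightarrow> 'a::{real_inner, polish_space}" where "hilbert_basis e"
proof -
  obtain D :: "'a set" where D: "countable D" "\<And>X. open X \<Longrightarrow> X \<noteq> {} \<Longrightarrow> \<exists>d\<in>D. d \<in> X"
    using countable_dense_setE by (metis)
  then have "D \<noteq> {}" using D(2)[of UNIV] by auto
  define d where "d = from_nat_into D"
  have d: "range d = D" using D(1) \<open>D \<noteq> {}\<close> by (simp add: d_def range_from_nat_into)
  define e where "e = gram_schmidt d"
  note orth = gram_schmidt_orthogonal[of _ _ d, folded e_def]
  note unit = gram_schmidt_unit_or_zero[of d, folded e_def]
  have "hilbert_basis e"
  proof
    fix x
    show "(\<lambda>k. (e k \<bullet> x) *\<^sub>R e k) sums x"
      unfolding sums_def
    proof (rule LIMSEQ_I)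
      fix r :: real assume "0 < r"
      then obtain m where m: "d m \<in> ball x r"
        using D(2)[of "ball x r"] d by (metis centre_in_ball empty_iff imageE open_ball)
      have "norm ((\<Sum>k<n. (e k \<bullet> x) *\<^sub>R e k) - x) < r" if "n \<ge> Suc m" for n
      proof -
        have "x - (\<Sum>k<n. (e k \<bullet> x) *\<^sub>R e k)
            = (x - d m) - (\<Sum>k<n. (e k \<bullet> (x - d m)) *\<^sub>R e k)"
          using gram_schmidt_partial_expansion[of m n d] that
          by (simp add: e_def inner_diff_right scaleR_diff_left sum_subtractf)
        also have "norm \<dots> \<le> norm (x - d m)"
          by (rule bessel_remainder) (use orth unit in auto)
        finally show ?thesis using m by (simp add: dist_norm norm_minus_commute)
      qed
      then show "\<exists>no. \<forall>n\<ge>no. norm ((\<Sum>k<n. (e k \<bullet> x) *\<^sub>R e k) - x) < r" by blast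
    qed
  qed (use orth unit in auto)
  then show ?thesis using that by blast
qed

context hilbert_basis
begin

lemma parseval: "(\<lambda>k. (e k \<bullet> x) * (e k \<bullet> y)) sums (x \<bullet> y)"
  using bounded_linear.sums[OF bounded_linear_inner_left expansion[of x], of y] by simp

lemma norm_sum_power2_le:
  assumes "finite I"
  shows "(norm (\<Sum>k\<in>I. f k *\<^sub>R e k))\<^sup>2 \<le> (\<Sum>k\<in>I. (f k)\<^sup>2)"
proof -
  have "(\<Sum>k\<in>I. f k *\<^sub>R e k) \<bullet> (\<Sum>k\<in>I. f k *\<^sub>R e k) = (\<Sum>k\<in>I. \<Sum>j\<in>I. f j * (f k * (e k \<bullet> e j)))"
    by (subst inner_sum_left) (simp add: inner_sum_right sum_distrib_left)
  also have "\<dots> = (\<Sum>k\<in>I. \<Sum>j\<in>{k}. f j * (f k * (e k \<bullet> e j)))"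
    by (intro sum.cong sum.mono_neutral_right) (use assms orthogonal in auto)
  also have "\<dots> \<le> (\<Sum>k\<in>I. (f k)\<^sup>2)"
  proof (rule sum_mono)
    fix k
    show "(\<Sum>j\<in>{k}. f j * (f k * (e k \<bullet> e j))) \<le> (f k)\<^sup>2"
      using unit_or_zero[of k] by (cases "e k = 0") (auto simp: power2_eq_square)
  qed
  finally show ?thesis by (simp add: power2_norm_eq_inner)
qed

lemma summable_synthesis:
  assumes "summable (\<lambda>k. (f k)\<^sup>2)"
  shows "summable (\<lambda>k. f k *\<^sub>R e k)"
proof -
  have "Cauchy (\<lambda>n. \<Sum>k<n. f k *\<^sub>R e k)"
  proof (rule CauchyI')
    fix r :: real assume "0 < r"
    then obtain N where N: "\<And>m n. m \<ge> N \<Longrightarrow> norm (\<Sum>k=m..<n. (f k)\<^sup>2) < r\<^sup>2"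
      using assms unfolding summable_Cauchy by (metis zero_less_power)
    have "norm ((\<Sum>k<m. f k *\<^sub>R e k) - (\<Sum>k<n. f k *\<^sub>R e k)) < r" if "m \<ge> N" "n > m" for m n
    proof -
      have "(\<Sum>k<n. f k *\<^sub>R e k) - (\<Sum>k<m. f k *\<^sub>R e k) = (\<Sum>k=m..<n. f k *\<^sub>R e k)"
        using sum_diff_nat_ivl[of 0 m n "\<lambda>k. f k *\<^sub>R e k"] that by (simp add: atLeast0LessThan)
      then have "(norm ((\<Sum>k<n. f k *\<^sub>R e k) - (\<Sum>k<m. f k *\<^sub>R e k)))\<^sup>2 < r\<^sup>2"
        using norm_sum_power2_le[of "{m..<n}" f] N[OF that(1), of n] by simp
      then show ?thesis using \<open>0 < r\<close> by (metis norm_minus_commute power2_less_imp_less less_imp_le)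
    qed
    then show "\<exists>M. \<forall>m\<ge>M. \<forall>n>m. dist (\<Sum>k<m. f k *\<^sub>R e k) (\<Sum>k<n. f k *\<^sub>R e k) < r"
      unfolding dist_norm by blast
  qed
  then show ?thesis unfolding summable_iff_convergent by (rule Cauchy_convergent)
qed

lemma inner_synthesis:
  assumes "summable (\<lambda>k. (f k)\<^sup>2)" "\<And>k. e k = 0 \<Longrightarrow> f k = 0"
  shows "e k \<bullet> (\<Sum>j. f j *\<^sub>R e j) = f k"
proof -
  have "(\<lambda>j. f j * (e k \<bullet> e j)) sums (e k \<bullet> (\<Sum>j. f j *\<^sub>R e j))"
    using bounded_linear.sums[OF bounded_linear_inner_right summable_sums[OF summable_synthesis[OF assms(1)]], of "e k"]
    by simp
  moreover have "(\<lambda>j. f j * (e k \<bullet> e j)) = (\<lambda>j. if j = k then f k else 0)"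
    using orthogonal[of k] unit_or_zero[of k] assms(2)[of k] by (cases "e k = 0") auto
  moreover have "(\<lambda>j. if j = k then f k else 0) sums f k"
    using sums_single[of k "\<lambda>_. f k"] by simp
  ultimately show ?thesis by (simp add: sums_unique2)
qed

lemma eq_if_coordinates_eq: "(\<And>k. e k \<bullet> x = e k \<bullet> y) \<Longrightarrow> x = y"
  using expansion[of x] expansion[of y] by (simp add: sums_unique2)

end

lemma additive_bounded_imp_linear:
  fixes f :: "real \<Rightarrow> real"
  assumes add: "\<And>x y. f (x + y) = f x + f y"
    and bounded: "\<And>x. 0 \<le> x \<Longrightarrow> x \<le> 1 \<Longrightarrow> \<bar>f x\<bar> \<le> C"
  shows "f x = x * f 1"
proof -
  define h where "h x = f x - x * f 1" for x
  have h_add: "h (x + y) = h x + h y" for x y by (simp add: h_def add algebra_simps)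
  have h0: "h 0 = 0" using h_add[of 0 0] by simp
  have h_nat: "h (of_nat n * x) = of_nat n * h x" for n x
    by (induction n) (simp_all add: h0 h_add algebra_simps)
  have h1: "h 1 = 0" by (simp add: h_def)
  have h_neg: "h (- x) = - h x" for x using h_add[of x "- x"] h0 by simp
  have h_int: "h (of_int z) = 0" for z
  proof (cases z rule: int_cases2)
    case (nonneg n) then show ?thesis using h_nat[of n 1] h1 by simp
  next
    case (nonpos n) then show ?thesis using h_nat[of n 1] h1 h_neg[of "real n"] by simp
  qed
  have h_frac: "h x = h (frac x)" for x
    using h_add[of "frac x" "of_int \<lfloor>x\<rfloor>"] h_int by (simp add: frac_def)
  have bd: "\<bar>h x\<bar> \<le> C + \<bar>f 1\<bar>" for x
  proof -
    have fr: "0 \<le> frac x" "frac x \<le> 1" by (simp_all add: frac_lt_1 less_imp_le)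
    have "\<bar>h (frac x)\<bar> \<le> \<bar>f (frac x)\<bar> + \<bar>frac x * f 1\<bar>" by (simp add: h_def)
    also have "\<bar>frac x * f 1\<bar> \<le> \<bar>f 1\<bar>" using fr by (simp add: abs_mult mult_left_le_one_le)
    finally show ?thesis using bounded[OF fr] h_frac[of x] by simp
  qed
  have "h x = 0"
  proof (rule ccontr)
    assume "h x \<noteq> 0"
    then obtain n where "C + \<bar>f 1\<bar> < of_nat n * \<bar>h x\<bar>"
      using ex_less_of_nat_mult[of "\<bar>h x\<bar>" "C + \<bar>f 1\<bar>"] by auto
    then show False using bd[of "of_nat n * x"] h_nat[of n x] by (simp add: abs_mult)
  qed
  then show ?thesis by (simp add: h_def)
qed

lemma half_sum_plus_half_diff:
  fixes x y :: "'a::real_vector"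
  shows "(1/2) *\<^sub>R (x + y) + (1/2) *\<^sub>R (x - y) = x"
proof -
  have "(1/2) *\<^sub>R (x + y) + (1/2) *\<^sub>R (x - y) = (1/2 + 1/2) *\<^sub>R x"
    by (simp only: scaleR_add_left scaleR_add_right scaleR_diff_right) simp
  then show ?thesis by simp
qed

lemma half_sum_minus_half_diff:
  fixes x y :: "'a::real_vector"
  shows "(1/2) *\<^sub>R (x + y) - (1/2) *\<^sub>R (x - y) = y"
proof -
  have "(1/2) *\<^sub>R (x + y) - (1/2) *\<^sub>R (x - y) = (1/2 + 1/2) *\<^sub>R y"
    by (simp only: scaleR_add_left scaleR_add_right scaleR_diff_right) simp
  then show ?thesis by simp
qed

locale bounded_quadratic_form =
  fixes p :: "'a::real_inner \<Rightarrow> real"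
  assumes parallelogram: "p (u + v) + p (u - v) = 2 * p u + 2 * p v"
    and nonneg: "0 \<le> p u"
    and le_inner: "p u \<le> u \<bullet> u"
begin

definition polar :: "'a \<Rightarrow> 'a \<Rightarrow> real" where
  "polar u v = (p (u + v) - p (u - v)) / 4"

lemma zero [simp]: "p 0 = 0"
  using nonneg[of 0] le_inner[of 0] by simp

lemma minus [simp]: "p (- u) = p u"
  using parallelogram[of 0 u] by simp

lemma minus_commute: "p (u - v) = p (v - u)"
  using minus[of "u - v"] by simp

lemma polar_commute: "polar u v = polar v u"
  by (simp add: polar_def add.commute minus_commute)

lemma polar_self: "polar u u = p u"
  using parallelogram[of u u] by (simp add: polar_def)

lemma polar_zero [simp]: "polar 0 v = 0"
  by (simp add: polar_def)

lemma polar_add: "polar (a + c) v = polar a v + polar c v"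
proof -
  have mid: "polar (u + w) v + polar (u - w) v = 2 * polar u v" for u w
    using parallelogram[of "u + v" w] parallelogram[of "u - v" w]
    by (simp add: polar_def algebra_simps diff_divide_distrib)
  have two: "polar (2 *\<^sub>R u) v = 2 * polar u v" for u
    using mid[of u u] by (simp add: scaleR_2)
  define u w where "u = (1/2) *\<^sub>R (a + c)" and "w = (1/2) *\<^sub>R (a - c)"
  have "u + w = a" "u - w = c" "2 *\<^sub>R u = a + c"
    by (simp_all only: u_def w_def half_sum_plus_half_diff half_sum_minus_half_diff) simp
  then show ?thesis using mid[of u w] two[of u] by simp
qed

lemma abs_polar_le: "\<bar>polar u v\<bar> \<le> (u \<bullet> u + v \<bullet> v) / 2"
  using parallelogram[of u v] nonneg[of "u + v"] nonneg[of "u - v"] le_inner[of u] le_inner[of v]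
  unfolding polar_def by (simp add: abs_le_iff field_simps)

lemma polar_scaleR: "polar (r *\<^sub>R u) v = r * polar u v"
proof -
  have "polar (r *\<^sub>R u) v = r * polar (1 *\<^sub>R u) v"
  proof (rule additive_bounded_imp_linear[where f = "\<lambda>r. polar (r *\<^sub>R u) v" and C = "(u \<bullet> u + v \<bullet> v) / 2"])
    show "polar ((x + y) *\<^sub>R u) v = polar (x *\<^sub>R u) v + polar (y *\<^sub>R u) v" for x y
      by (simp add: scaleR_add_left polar_add)
    show "\<bar>polar (x *\<^sub>R u) v\<bar> \<le> (u \<bullet> u + v \<bullet> v) / 2" if "0 \<le> x" "x \<le> 1" for x
    proof -
      have "x * x \<le> 1" using that by (simp add: mult_le_one)
      then have "(x *\<^sub>R u) \<bullet> (x *\<^sub>R u) \<le> u \<bullet> u"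
        by (simp add: mult.assoc[symmetric] mult_left_le_one_le that)
      then show ?thesis using abs_polar_le[of "x *\<^sub>R u" v] by simp
    qed
  qed
  then show ?thesis by simp
qed

lemma bounded_linear_polar: "bounded_linear (polar u)"
proof (rule bounded_linear_intro[where K = "(u \<bullet> u + 1) / 2"])
  show "polar u (x + y) = polar u x + polar u y" for x y
    by (simp add: polar_commute[of u] polar_add)
  show sc: "polar u (r *\<^sub>R x) = r *\<^sub>R polar u x" for r x
    by (simp add: polar_commute[of u] polar_scaleR)
  show "norm (polar u x) \<le> norm x * ((u \<bullet> u + 1) / 2)" for x
  proof (cases "x = 0")
    case True
    then show ?thesis by (simp add: polar_commute[of u])
  next
    case False
    have "polar u x = norm x * polar u (sgn x)"
      using sc[of "norm x" "sgn x"] False by (simp add: sgn_div_norm)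
    moreover have "\<bar>polar u (sgn x)\<bar> \<le> (u \<bullet> u + 1) / 2"
      using abs_polar_le[of u "sgn x"] False by (simp add: dot_square_norm norm_sgn)
    ultimately show ?thesis
      using mult_left_mono[of "\<bar>polar u (sgn x)\<bar>" "(u \<bullet> u + 1) / 2" "norm x"] by (simp add: abs_mult)
  qed
qed

end

lemma (in hilbert_basis) bounded_quadratic_form_operator:
  assumes "bounded_quadratic_form p"
  obtains t :: "'a \<Rightarrow> 'a" where
    "\<And>u v. t u \<bullet> v = bounded_quadratic_form.polar p u v" "\<And>u. norm (t u) \<le> norm u"
proof -
  interpret bounded_quadratic_form p by fact
  have lin: "linear (polar u)" for u
    using bounded_linear_polar bounded_linear.linear by blast
  have bessel: "(\<Sum>k<n. (polar u (e k))\<^sup>2) \<le> u \<bullet> u" for u n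
  proof -
    define w where "w = (\<Sum>k<n. polar u (e k) *\<^sub>R e k)"
    have "(\<Sum>k<n. (polar u (e k))\<^sup>2) = polar u w"
      by (simp add: w_def linear_sum[OF lin] linear_scale[OF lin] power2_eq_square)
    also have "\<dots> \<le> (u \<bullet> u + w \<bullet> w) / 2" using abs_polar_le[of u w] by simp
    finally show ?thesis
      using norm_sum_power2_le[of "{..<n}" "\<lambda>k. polar u (e k)"] by (simp add: w_def power2_norm_eq_inner)
  qed
  have summ: "summable (\<lambda>k. (polar u (e k))\<^sup>2)" for u
    by (rule summableI_nonneg_bounded[where x = "u \<bullet> u"]) (use bessel in auto)
  define t where "t u = (\<Sum>k. polar u (e k) *\<^sub>R e k)" for u
  have t: "e k \<bullet> t u = polar u (e k)" for k u
    unfolding t_def by (rule inner_synthesis[OF summ]) (simp add: linear_0[OF lin])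
  have inner_t: "t u \<bullet> v = polar u v" for u v
  proof -
    have "(\<lambda>k. polar u (e k) * (e k \<bullet> v)) sums (t u \<bullet> v)"
      using parseval[of "t u" v] by (simp add: t)
    moreover have "(\<lambda>k. polar u (e k) * (e k \<bullet> v)) sums polar u v"
      using bounded_linear.sums[OF bounded_linear_polar expansion[of v], of u]
      by (simp add: linear_scale[OF lin] mult.commute)
    ultimately show ?thesis by (rule sums_unique2)
  qed
  have "norm (t u) \<le> norm u" for u
  proof -
    have "(\<lambda>k. (polar u (e k))\<^sup>2) sums (t u \<bullet> t u)"
      using parseval[of "t u" "t u"] by (simp add: t power2_eq_square)
    then have "t u \<bullet> t u \<le> u \<bullet> u"
      using bessel[of u] by (intro LIMSEQ_le_const2) (auto simp: sums_def)
    then show ?thesis by (simp add: norm_le)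
  qed
  then show ?thesis using inner_t that by blast
qed

text \<open>The operator is found through its quadratic form, the Legendre-type transform
  \<open>p u = sup\<^sub>x (2 \<langle>A x, u\<rangle> - \<langle>A x, B x\<rangle>)\<close>; this is the smallest
  non-negative solution of \<open>t B = A\<close> (the Krein extension).\<close>

lemma (in hilbert_basis) positive_contraction_factorization:
  fixes A B :: "'b::real_vector \<Rightarrow> 'a"
  assumes "linear A" "linear B"
    and sym: "\<And>x y. A x \<bullet> B y = A y \<bullet> B x"
    and dom: "\<And>x. A x \<bullet> A x \<le> A x \<bullet> B x"
  obtains t :: "'a \<Rightarrow> 'a" where "bounded_linear t" "\<And>u v. t u \<bullet> v = u \<bullet> t v"
    "\<And>u. 0 \<le> t u \<bullet> u" "onorm t \<le> 1" "\<And>x. t (B x) = A x"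
proof -
  interpret A: linear A by fact
  interpret B: linear B by fact
  define q where "q x u = 2 * (A x \<bullet> u) - A x \<bullet> B x" for x u
  define p where "p u = (SUP x. q x u)" for u
  have q_le: "q x u \<le> u \<bullet> u" for x u
  proof -
    have "0 \<le> (A x - u) \<bullet> (A x - u)" by simp
    then show ?thesis using dom[of x] by (simp add: q_def inner_diff inner_commute)
  qed
  have bdd: "bdd_above (range (\<lambda>x. q x u))" for u
    using q_le by (intro bdd_aboveI2) auto
  have q_le_p: "q x u \<le> p u" for x u
    unfolding p_def by (rule cSUP_upper[OF _ bdd]) simp
  have p_le: "p u \<le> c" if "\<And>x. q x u \<le> c" for u c
    unfolding p_def by (rule cSUP_least) (use that in auto)
  have p_sum_le: "a * p u + a * p v \<le> c" if "\<And>x y. a * q x u + a * q y v \<le> c" "a > 0" for u v a c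
  proof -
    have "p v \<le> (c - a * q x u) / a" for x
      using that(1)[of x] that(2) by (intro p_le) (simp add: field_simps)
    then have "q x u \<le> (c - a * p v) / a" for x
      using that(2) by (simp add: field_simps)
    then have "p u \<le> (c - a * p v) / a" by (rule p_le)
    then show ?thesis using that(2) by (simp add: field_simps)
  qed
  have q_par: "q (x + y) (u + v) + q (x - y) (u - v) = 2 * q x u + 2 * q y v" for x y u v
    by (simp add: q_def A.add A.diff B.add B.diff inner_add inner_diff algebra_simps)
  interpret p: bounded_quadratic_form p
  proof
    fix u v
    show "0 \<le> p u" using q_le_p[of 0 u] by (simp add: q_def A.zero)
    show "p u \<le> u \<bullet> u" using q_le by (rule p_le)
    have "1 * p (u + v) + 1 * p (u - v) \<le> 2 * p u + 2 * p v"
    proof (rule p_sum_le)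
      fix x y :: 'b
      define x' y' where "x' = (1/2) *\<^sub>R (x + y)" and "y' = (1/2) *\<^sub>R (x - y)"
      have "x' + y' = x" "x' - y' = y"
        by (simp_all only: x'_def y'_def half_sum_plus_half_diff half_sum_minus_half_diff)
      then show "1 * q x (u + v) + 1 * q y (u - v) \<le> 2 * p u + 2 * p v"
        using q_par[of x' y' u v] q_le_p[of x' u] q_le_p[of y' v] by simp
    qed simp
    moreover have "2 * p u + 2 * p v \<le> p (u + v) + p (u - v)"
    proof (rule p_sum_le)
      fix x y
      show "2 * q x u + 2 * q y v \<le> p (u + v) + p (u - v)"
        using q_par[of x y u v] q_le_p[of "x + y" "u + v"] q_le_p[of "x - y" "u - v"] by simp
    qed simp
    ultimately show "p (u + v) + p (u - v) = 2 * p u + 2 * p v" by simp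
  qed
  obtain t where t: "\<And>u v. t u \<bullet> v = p.polar u v" and norm_t: "\<And>u. norm (t u) \<le> norm u"
    using bounded_quadratic_form_operator[OF p.bounded_quadratic_form_axioms] by blast
  have "bounded_linear t"
  proof (rule bounded_linear_intro[where K = 1])
    show "t (u + v) = t u + t v" for u v
      by (rule vector_eq_rdot[THEN iffD1]) (simp add: t inner_add_left p.polar_add)
    show "t (r *\<^sub>R u) = r *\<^sub>R t u" for r u
      by (rule vector_eq_rdot[THEN iffD1]) (simp add: t p.polar_scaleR)
  qed (use norm_t in simp)
  moreover have "t u \<bullet> v = u \<bullet> t v" for u v
    using p.polar_commute[of u v] by (simp add: t[symmetric] inner_commute)
  moreover have "0 \<le> t u \<bullet> u" for u
    by (simp add: t p.polar_self p.nonneg)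
  moreover have "onorm t \<le> 1"
    by (rule onorm_bound) (use norm_t in auto)
  moreover have "t (B x) = A x" for x
  proof (rule vector_eq_rdot[THEN iffD1], rule allI)
    fix u
    have q_shift: "q (y + x) (u + B x) = q y u + (2 * (A x \<bullet> u) + A x \<bullet> B x)" for y x
      using sym[of x y] by (simp add: q_def A.add B.add inner_add algebra_simps)
    have ge: "p u + (2 * (A x \<bullet> u) + A x \<bullet> B x) \<le> p (u + B x)" for x
    proof -
      have "q y u \<le> p (u + B x) - (2 * (A x \<bullet> u) + A x \<bullet> B x)" for y
        using q_le_p[of "y + x" "u + B x"] q_shift[of y x] by simp
      from p_le[OF this] show ?thesis by simp
    qed
    have le: "p (u + B x) \<le> p u + (2 * (A x \<bullet> u) + A x \<bullet> B x)" for x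
    proof (rule p_le)
      fix y show "q y (u + B x) \<le> p u + (2 * (A x \<bullet> u) + A x \<bullet> B x)"
        using q_shift[of "y - x" x] q_le_p[of "y - x" u] by simp
    qed
    have shift: "p (u + B x) = p u + (2 * (A x \<bullet> u) + A x \<bullet> B x)" for x
      using ge le by (rule antisym[rotated])
    have "p.polar u (B x) = A x \<bullet> u"
      using shift[of x] shift[of "- x"] by (simp add: p.polar_def A.neg B.neg)
    then show "t (B x) \<bullet> u = A x \<bullet> u"
      by (simp add: t p.polar_commute)
  qed
  ultimately show ?thesis using that by blast
qed

section \<open>Gram representation of positive semidefinite kernels\<close>

lemma finite_support_combine:
  assumes "finite {n. f n \<noteq> 0}" "finite {n. g n \<noteq> 0}" "\<And>n. f n = 0 \<Longrightarrow> g n = 0 \<Longrightarrow> h n = 0"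
  shows "finite {n. h n \<noteq> 0}"
  by (rule finite_subset[OF _ finite_UnI[OF assms(1,2)]]) (use assms(3) in blast)

typedef finseq = "{f :: nat \<Rightarrow> real. finite {n. f n \<noteq> 0}}"
  morphisms coord Abs_finseq
  by (rule exI[of _ "\<lambda>_. 0"]) simp

setup_lifting type_definition_finseq

lemma finite_coord: "finite {n. coord x n \<noteq> 0}"
  using coord[of x] by simp

lemma summable_coord_mult: "summable (\<lambda>n. coord x n * f n :: real)"
  by (rule summable_finite[OF finite_coord[of x]]) auto

instantiation finseq :: real_inner
begin

lift_definition zero_finseq :: finseq is "\<lambda>_. 0" by simp

lift_definition plus_finseq :: "finseq \<Rightarrow> finseq \<Rightarrow> finseq" is "\<lambda>f g n. f n + g n"
  by (erule (1) finite_support_combine) simp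

lift_definition minus_finseq :: "finseq \<Rightarrow> finseq \<Rightarrow> finseq" is "\<lambda>f g n. f n - g n"
  by (erule (1) finite_support_combine) simp

lift_definition uminus_finseq :: "finseq \<Rightarrow> finseq" is "\<lambda>f n. - f n"
  by simp

lift_definition scaleR_finseq :: "real \<Rightarrow> finseq \<Rightarrow> finseq" is "\<lambda>r f n. r * f n"
  by (rule finite_subset[rotated]) auto

definition inner_finseq :: "finseq \<Rightarrow> finseq \<Rightarrow> real" where
  "inner_finseq x y = (\<Sum>n. coord x n * coord y n)"

definition norm_finseq :: "finseq \<Rightarrow> real" where
  "norm_finseq x = sqrt (x \<bullet> x)"

definition dist_finseq :: "finseq \<Rightarrow> finseq \<Rightarrow> real" where
  "dist_finseq x y = norm (x - y)"

definition sgn_finseq :: "finseq \<Rightarrow> finseq" where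
  "sgn_finseq x = inverse (norm x) *\<^sub>R x"

definition uniformity_finseq :: "(finseq \<times> finseq) filter" where
  "uniformity_finseq = (INF e\<in>{0<..}. principal {(x, y). dist x y < e})"

definition open_finseq :: "finseq set \<Rightarrow> bool" where
  "open_finseq U = (\<forall>x\<in>U. \<forall>\<^sub>F (x', y) in uniformity. x' = x \<longrightarrow> y \<in> U)"

instance
proof
  fix x y z :: finseq and r s :: real
  show "x + y + z = x + (y + z)" "x + y = y + x" "0 + x = x" "- x + x = 0" "x - y = x + - y"
    "r *\<^sub>R (x + y) = r *\<^sub>R x + r *\<^sub>R y" "(r + s) *\<^sub>R x = r *\<^sub>R x + s *\<^sub>R x"
    "r *\<^sub>R s *\<^sub>R x = (r * s) *\<^sub>R x" "1 *\<^sub>R x = x"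
    by (transfer; auto simp: algebra_simps)+
  show "x \<bullet> y = y \<bullet> x" by (simp add: inner_finseq_def mult.commute)
  show "(x + y) \<bullet> z = x \<bullet> z + y \<bullet> z"
    using suminf_add[OF summable_coord_mult summable_coord_mult, of x "coord z" y "coord z"]
    by (simp add: inner_finseq_def plus_finseq.rep_eq distrib_right)
  show "(r *\<^sub>R x) \<bullet> y = r * (x \<bullet> y)"
    using suminf_mult[OF summable_coord_mult, of r x "coord y"]
    by (simp add: inner_finseq_def scaleR_finseq.rep_eq mult.assoc)
  show nonneg: "0 \<le> x \<bullet> x"
    unfolding inner_finseq_def by (rule suminf_nonneg[OF summable_coord_mult]) simp
  have "(x \<bullet> x = 0) = (\<forall>n. coord x n * coord x n = 0)"
    unfolding inner_finseq_def by (rule suminf_eq_zero_iff[OF summable_coord_mult]) simp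
  then show "(x \<bullet> x = 0) = (x = 0)"
    by (auto simp: coord_inject[symmetric] zero_finseq.rep_eq)
qed (simp_all add: norm_finseq_def dist_finseq_def sgn_finseq_def uniformity_finseq_def open_finseq_def)

end

definition psd_kernel :: "('i \<Rightarrow> 'i \<Rightarrow> real) \<Rightarrow> bool" where
  "psd_kernel c \<longleftrightarrow> (\<forall>m n. c m n = c n m) \<and>
     (\<forall>F x. finite F \<longrightarrow> 0 \<le> (\<Sum>m\<in>F. \<Sum>n\<in>F. x m * x n * c m n))"

lemma psd_kernel_commute: "psd_kernel c \<Longrightarrow> c m n = c n m"
  by (auto simp: psd_kernel_def)

lemma psd_kernel_sum_nonneg:
  "psd_kernel c \<Longrightarrow> finite F \<Longrightarrow> 0 \<le> (\<Sum>m\<in>F. \<Sum>n\<in>F. x m * x n * c m n)"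
  by (auto simp: psd_kernel_def)

lemma psd_kernel_diagonal_nonneg: "psd_kernel c \<Longrightarrow> 0 \<le> c k k"
  using psd_kernel_sum_nonneg[of c "{k}" "\<lambda>_. 1"] by simp

lemma psd_kernel_cross_bound:
  assumes "psd_kernel c"
  shows "0 \<le> c m m + 2 * t * c m k + t\<^sup>2 * c k k"
proof (cases "m = k")
  case True
  have "0 \<le> (1 + t)\<^sup>2 * c k k" using psd_kernel_diagonal_nonneg[OF assms] by simp
  then show ?thesis using True by (simp add: power2_eq_square algebra_simps)
next
  case False
  then show ?thesis
    using psd_kernel_sum_nonneg[OF assms, of "{m, k}" "\<lambda>i. if i = m then 1 else t"]
      psd_kernel_commute[OF assms, of m k]
    by (auto simp: power2_eq_square algebra_simps split: if_splits)
qed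

lemma psd_kernel_abs_le: "psd_kernel c \<Longrightarrow> \<bar>c m k\<bar> \<le> (c m m + c k k) / 2"
  using psd_kernel_cross_bound[of c m 1 k] psd_kernel_cross_bound[of c m "- 1" k] by simp

lemma psd_kernel_zero_column:
  assumes "psd_kernel c" "c k k = 0"
  shows "c m k = 0"
proof (rule ccontr)
  assume "c m k \<noteq> 0"
  then show False
    using psd_kernel_cross_bound[OF assms(1), of m "- (c m m + 1) / (2 * c m k)" k] assms(2)
    by (simp add: field_simps)
qed

lemma psd_kernel_schur_step:
  fixes c :: "'i \<Rightarrow> 'i \<Rightarrow> real"
  assumes c: "psd_kernel c"
  shows "psd_kernel (\<lambda>m n. c m n - c m k * c n k / c k k)"
  unfolding psd_kernel_def
proof (intro conjI allI impI)
  show "c m n - c m k * c n k / c k k = c n m - c n k * c m k / c k k" for m n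
    by (simp add: psd_kernel_commute[OF c, of m n] mult.commute)
next
  fix F :: "'i set" and x :: "'i \<Rightarrow> real" assume F: "finite F"
  define b where "b = (\<Sum>m\<in>F. x m * c m k)"
  define s where "s = b / c k k"
  define y where "y m = (if m \<in> F then x m else 0)" for m
  let ?F = "insert k F"
  let ?d = "\<lambda>m. if m = k then 1 else 0 :: real"
  have fF: "finite ?F" using F by simp
  have y1: "(\<Sum>m\<in>?F. y m * g m) = (\<Sum>m\<in>F. x m * g m)" for g :: "'i \<Rightarrow> real"
    by (rule sum.mono_neutral_cong_right[OF fF]) (auto simp: y_def)
  have yc: "(\<Sum>m\<in>?F. y m * c m k) = b" by (simp add: y1 b_def)
  have yc': "(\<Sum>m\<in>?F. y m * c k m) = b" using yc by (simp add: psd_kernel_commute[OF c, of k])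
  have d1: "(\<Sum>m\<in>?F. ?d m * g m) = g k" for g :: "'i \<Rightarrow> real"
    using sum.delta[OF fF, of k "\<lambda>_. g k"] by (simp add: if_distrib[of "\<lambda>z. z * _"] cong: if_cong)
  have row: "(\<Sum>n\<in>?F. (y n - s * ?d n) * g n) = (\<Sum>n\<in>?F. y n * g n) - s * g k" for g :: "'i \<Rightarrow> real"
  proof -
    have "(\<Sum>n\<in>?F. (y n - s * ?d n) * g n) = (\<Sum>n\<in>?F. y n * g n) - s * (\<Sum>n\<in>?F. ?d n * g n)"
      by (simp only: left_diff_distrib sum_subtractf sum_distrib_left mult.assoc)
    then show ?thesis by (simp only: d1)
  qed
  have "0 \<le> (\<Sum>m\<in>?F. \<Sum>n\<in>?F. (y m - s * ?d m) * (y n - s * ?d n) * c m n)"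
    by (rule psd_kernel_sum_nonneg[OF c fF])
  also have "\<dots> = (\<Sum>m\<in>?F. (y m - s * ?d m) * (\<Sum>n\<in>?F. (y n - s * ?d n) * c m n))"
    by (simp only: sum_distrib_left mult.assoc)
  also have "\<dots> = (\<Sum>m\<in>?F. y m * ((\<Sum>n\<in>?F. y n * c m n) - s * c m k)) - s * ((\<Sum>n\<in>?F. y n * c k n) - s * c k k)"
    by (simp only: row)
  also have "\<dots> = (\<Sum>m\<in>F. x m * (\<Sum>n\<in>F. x n * c m n)) - s * b - s * (b - s * c k k)"
  proof -
    have "(\<Sum>m\<in>?F. y m * ((\<Sum>n\<in>?F. y n * c m n) - s * c m k))
        = (\<Sum>m\<in>?F. y m * (\<Sum>n\<in>?F. y n * c m n)) - s * (\<Sum>m\<in>?F. y m * c m k)"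
      by (simp only: right_diff_distrib sum_subtractf sum_distrib_left mult.left_commute[of s])
    then show ?thesis by (simp only: yc yc' y1)
  qed
  also have "\<dots> = (\<Sum>m\<in>F. x m * (\<Sum>n\<in>F. x n * c m n)) - b * b / c k k"
    by (cases "c k k = 0") (simp_all add: s_def field_simps)
  also have "\<dots> = (\<Sum>m\<in>F. \<Sum>n\<in>F. x m * x n * (c m n - c m k * c n k / c k k))"
  proof -
    have "b * b / c k k = (\<Sum>m\<in>F. \<Sum>n\<in>F. x m * x n * (c m k * c n k / c k k))"
      by (simp add: b_def sum_product sum_divide_distrib ac_simps)
    then show ?thesis
      by (simp add: right_diff_distrib sum_subtractf sum_distrib_left mult.assoc)
  qed
  finally show "0 \<le> (\<Sum>m\<in>F. \<Sum>n\<in>F. x m * x n * (c m n - c m k * c n k / c k k))" .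
qed

text \<open>Symmetric Gaussian elimination; a vanishing pivot is harmless since then its whole
  column vanishes and \<open>x / 0 = 0\<close>.\<close>

fun schur_iterate :: "(nat \<Rightarrow> nat \<Rightarrow> real) \<Rightarrow> nat \<Rightarrow> nat \<Rightarrow> nat \<Rightarrow> real" where
  "schur_iterate c 0 m n = c m n"
| "schur_iterate c (Suc k) m n = schur_iterate c k m n -
     schur_iterate c k m k * schur_iterate c k n k / schur_iterate c k k k"

lemma psd_kernel_schur_iterate: "psd_kernel c \<Longrightarrow> psd_kernel (schur_iterate c k)"
proof (induction k)
  case 0
  moreover have "schur_iterate c 0 = c" by (intro ext) simp
  ultimately show ?case by simp
next
  case (Suc k)
  have "schur_iterate c (Suc k) = (\<lambda>m n. schur_iterate c k m n -
      schur_iterate c k m k * schur_iterate c k n k / schur_iterate c k k k)"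
    by (intro ext) simp
  then show ?case using psd_kernel_schur_step[of "schur_iterate c k" k] Suc by simp
qed

lemma schur_iterate_eliminated: "psd_kernel c \<Longrightarrow> k < N \<Longrightarrow> schur_iterate c N m k = 0"
proof (induction N arbitrary: m)
  case (Suc N)
  note psd = psd_kernel_schur_iterate[OF Suc.prems(1), of N]
  show ?case
  proof (cases "k = N")
    case True
    then show ?thesis using psd_kernel_zero_column[OF psd, of N m] by (cases "schur_iterate c N N N = 0") auto
  next
    case False
    then have "k < N" using Suc.prems by simp
    then show ?thesis using Suc.IH[of m] Suc.IH[of N] Suc.prems psd_kernel_commute[OF psd, of k N]
      by simp
  qed
qed simp

lemma gram_vectors_nat:
  assumes c: "psd_kernel c"
  obtains v :: "nat \<Rightarrow> finseq" where "\<And>m n. v m \<bullet> v n = c m n"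
proof -
  define L where "L m k = schur_iterate c k m k / sqrt (schur_iterate c k k k)" for m k
  note psd = psd_kernel_schur_iterate[OF c]
  have L_mult: "L m k * L n k = schur_iterate c k m k * schur_iterate c k n k / schur_iterate c k k k" for m n k
    using psd_kernel_diagonal_nonneg[OF psd, of k k] by (simp add: L_def)
  have telescope: "c m n = schur_iterate c N m n + (\<Sum>k<N. L m k * L n k)" for m n N
    by (induction N) (simp_all add: L_mult)
  have L_zero: "L m k = 0" if "m < k" for m k
    using schur_iterate_eliminated[OF c that, of k] psd_kernel_commute[OF psd, of k m k] by (simp add: L_def)
  define v where "v m = Abs_finseq (L m)" for m
  have "finite {k. L m k \<noteq> 0}" for m
    by (rule finite_subset[of _ "{..m}"]) (use L_zero not_less in auto)
  then have coord: "coord (v m) = L m" for m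
    unfolding v_def by (intro Abs_finseq_inverse) simp
  have "v m \<bullet> v n = c m n" for m n
  proof -
    have "v m \<bullet> v n = (\<Sum>k<Suc m. L m k * L n k)"
      unfolding inner_finseq_def coord by (rule suminf_finite) (use L_zero in auto)
    moreover have "schur_iterate c (Suc m) m n = 0"
      using schur_iterate_eliminated[OF c, of m "Suc m" n] psd_kernel_commute[OF psd, of "Suc m" m n]
      by simp
    ultimately show ?thesis using telescope[of m n "Suc m"] by simp
  qed
  then show ?thesis using that by blast
qed

lemma psd_kernel_reindex:
  fixes c :: "'i \<Rightarrow> 'i \<Rightarrow> real" and f :: "'j \<Rightarrow> 'i"
  assumes c: "psd_kernel c" and "inj f"
  shows "psd_kernel (\<lambda>m n. c (f m) (f n))"
  unfolding psd_kernel_def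
proof (intro conjI allI impI)
  show "c (f m) (f n) = c (f n) (f m)" for m n by (rule psd_kernel_commute[OF c])
next
  fix F :: "'j set" and x :: "'j \<Rightarrow> real" assume "finite F"
  moreover have "inj_on f F" "inv f (f m) = m" for m
    using assms(2) by (auto intro: inj_on_subset)
  ultimately show "0 \<le> (\<Sum>m\<in>F. \<Sum>n\<in>F. x m * x n * c (f m) (f n))"
    using psd_kernel_sum_nonneg[OF c, of "f ` F" "\<lambda>i. x (inv f i)"]
    by (simp add: sum.reindex)
qed

lemma gram_vectors:
  fixes c :: "nat \<times> nat \<Rightarrow> nat \<times> nat \<Rightarrow> real"
  assumes c: "psd_kernel c"
  obtains v :: "nat \<times> nat \<Rightarrow> finseq" where "\<And>m n. v m \<bullet> v n = c m n"
proof -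
  have "psd_kernel (\<lambda>m n. c (prod_decode m) (prod_decode n))"
    by (rule psd_kernel_reindex[OF c]) (rule inj_prod_decode)
  then obtain w :: "nat \<Rightarrow> finseq" where "\<And>m n. w m \<bullet> w n = c (prod_decode m) (prod_decode n)"
    using gram_vectors_nat by blast
  then show ?thesis using that[of "\<lambda>m. w (prod_encode m)"] by simp
qed

lemma psd_kernel_gram:
  fixes v :: "'i \<Rightarrow> 'b::real_inner"
  shows "psd_kernel (\<lambda>m n. v m \<bullet> v n)"
  unfolding psd_kernel_def
proof (intro conjI allI impI)
  fix F :: "'i set" and x :: "'i \<Rightarrow> real"
  have "(\<Sum>m\<in>F. \<Sum>n\<in>F. x m * x n * (v m \<bullet> v n)) = (\<Sum>m\<in>F. x m *\<^sub>R v m) \<bullet> (\<Sum>n\<in>F. x n *\<^sub>R v n)"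
    by (subst inner_sum_left) (simp add: inner_sum_right sum_distrib_left ac_simps)
  then show "0 \<le> (\<Sum>m\<in>F. \<Sum>n\<in>F. x m * x n * (v m \<bullet> v n))" by simp
qed (rule inner_commute)

section \<open>Gaussian measures on a Hilbert space\<close>

lemma integrable_mult_squares:
  fixes f g :: "'x \<Rightarrow> real"
  assumes [measurable]: "f \<in> borel_measurable M" "g \<in> borel_measurable M"
    and "integrable M (\<lambda>x. (f x)\<^sup>2)" "integrable M (\<lambda>x. (g x)\<^sup>2)"
  shows "integrable M (\<lambda>x. f x * g x)"
proof (rule Bochner_Integration.integrable_bound)
  show "integrable M (\<lambda>x. (f x)\<^sup>2 + (g x)\<^sup>2)" using assms by simp
  have "2 * \<bar>a * b\<bar> \<le> a\<^sup>2 + b\<^sup>2" for a b :: real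
    using sum_squares_bound[of "\<bar>a\<bar>" "\<bar>b\<bar>"] by (simp add: abs_mult)
  then show "AE x in M. norm (f x * g x) \<le> norm ((f x)\<^sup>2 + (g x)\<^sup>2)"
    by (intro AE_I2) (smt (verit, best) real_norm_def)
qed simp

lemma centred_gaussian_real_moments:
  assumes "centred_gaussian_real \<nu>"
  obtains \<sigma> :: real where "\<sigma> \<ge> 0"
    "has_bochner_integral \<nu> (\<lambda>x. x\<^sup>2) (\<sigma>\<^sup>2)"
    "has_bochner_integral \<nu> (\<lambda>x. x ^ 4) (3 * \<sigma> ^ 4)"
    "\<And>t. char \<nu> t = complex_of_real (exp (- (\<sigma> * t)\<^sup>2 / 2))"
  using assms unfolding centred_gaussian_real_def
proof (elim disjE exE conjE)
  assume \<nu>: "\<nu> = return borel 0"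
  have "has_bochner_integral \<nu> (\<lambda>x. f x) (f 0)" if "f \<in> borel_measurable borel" for f :: "real \<Rightarrow> real"
    using that unfolding \<nu> has_bochner_integral_iff
    by (auto simp: integral_return integrable_iff_bounded nn_integral_return)
  from this[of "\<lambda>x. x\<^sup>2"] this[of "\<lambda>x. x ^ 4"] show ?thesis
    by (intro that[of 0]) (auto simp: char_def \<nu> integral_return)
next
  fix \<sigma> :: real assume "\<sigma> > 0" and \<nu>: "\<nu> = density lborel (normal_density 0 \<sigma>)"
  have dens: "has_bochner_integral \<nu> f c"
    if "has_bochner_integral lborel (\<lambda>x. normal_density 0 \<sigma> x * f x) c" "f \<in> borel_measurable borel"
    for f :: "real \<Rightarrow> real" and c
    unfolding \<nu> using that \<open>\<sigma> > 0\<close> by (intro has_bochner_integral_density) auto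
  have 2: "has_bochner_integral \<nu> (\<lambda>x. x\<^sup>2) (\<sigma>\<^sup>2)"
    using normal_moment_even[OF \<open>\<sigma> > 0\<close>, of 0 1] by (intro dens) (simp_all add: fact_numeral)
  have "(fact (2 * 2) / ((2 / \<sigma>\<^sup>2)\<^sup>2 * fact 2) :: real) = 3 * \<sigma> ^ 4"
    using \<open>\<sigma> > 0\<close> by (simp add: fact_numeral power2_eq_square power4_eq_xxxx)
  then have 4: "has_bochner_integral \<nu> (\<lambda>x. x ^ 4) (3 * \<sigma> ^ 4)"
    using normal_moment_even[OF \<open>\<sigma> > 0\<close>, of 0 2] by (intro dens) simp_all
  interpret prob_space \<nu> unfolding \<nu> by (rule prob_space_normal_density[OF \<open>\<sigma> > 0\<close>])
  have id: "distributed \<nu> lborel (\<lambda>x. x) (normal_density 0 \<sigma>)"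
    unfolding distributed_def \<nu> by (auto simp: distr_id2 intro!: measurable_ident_sets)
  then have std: "distr \<nu> lborel (\<lambda>x. x / \<sigma>) = std_normal_distribution"
    using normal_standard_normal_convert[OF \<open>\<sigma> > 0\<close>, of "\<lambda>x. x" 0] by (simp add: distributed_def)
  have "char \<nu> t = complex_of_real (exp (- (\<sigma> * t)\<^sup>2 / 2))" for t
  proof -
    have "char \<nu> t = (CLINT x|\<nu>. iexp ((\<sigma> * t) * (x / \<sigma>)))"
      using \<open>\<sigma> > 0\<close> by (simp add: char_def)
    also have "\<dots> = char (distr \<nu> lborel (\<lambda>x. x / \<sigma>)) (\<sigma> * t)"
      unfolding char_def by (subst integral_distr) (auto simp: \<nu>)
    finally show ?thesis by (simp add: std char_std_normal_distribution)
  qed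
  then show ?thesis using that[of \<sigma>] 2 4 \<open>\<sigma> > 0\<close> by simp
qed

locale inner_gaussian =
  fixes \<mu> :: "'a::{real_inner, polish_space} measure"
  assumes gaussian: "centred_gaussian \<mu>"
begin

sublocale prob_space \<mu>
  using gaussian by (simp add: centred_gaussian_def)

lemma sets_eq [measurable_cong, simp]: "sets \<mu> = sets borel"
  using gaussian by (simp add: centred_gaussian_def)

lemma space_eq [simp]: "space \<mu> = UNIV"
  using sets_eq_imp_space_eq[OF sets_eq] by simp

definition var :: "'a \<Rightarrow> real" where
  "var h = (\<integral>x. (h \<bullet> x)\<^sup>2 \<partial>\<mu>)"

lemma inner_moments:
  shows integrable_inner_power2: "integrable \<mu> (\<lambda>x. (h \<bullet> x)\<^sup>2)"
    and integrable_inner_power4: "integrable \<mu> (\<lambda>x. (h \<bullet> x) ^ 4)"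
    and integral_inner_power4: "(\<integral>x. (h \<bullet> x) ^ 4 \<partial>\<mu>) = 3 * (var h)\<^sup>2"
    and integral_cos_inner: "(\<integral>x. cos (h \<bullet> x) \<partial>\<mu>) = exp (- var h / 2)"
    and integral_sin_inner: "(\<integral>x. sin (h \<bullet> x) \<partial>\<mu>) = 0"
proof -
  let ?\<nu> = "distr \<mu> borel (\<lambda>x. h \<bullet> x)"
  have "centred_gaussian_real ?\<nu>" using gaussian by (simp add: centred_gaussian_def)
  then obtain \<sigma> where \<sigma>: "has_bochner_integral ?\<nu> (\<lambda>x. x\<^sup>2) (\<sigma>\<^sup>2)"
    "has_bochner_integral ?\<nu> (\<lambda>x. x ^ 4) (3 * \<sigma> ^ 4)"
    "\<And>t. char ?\<nu> t = complex_of_real (exp (- (\<sigma> * t)\<^sup>2 / 2))"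
    by (rule centred_gaussian_real_moments) blast
  have 2: "has_bochner_integral \<mu> (\<lambda>x. (h \<bullet> x)\<^sup>2) (\<sigma>\<^sup>2)"
    using \<sigma>(1) by (simp add: has_bochner_integral_iff integrable_distr_eq integral_distr)
  have 4: "has_bochner_integral \<mu> (\<lambda>x. (h \<bullet> x) ^ 4) (3 * \<sigma> ^ 4)"
    using \<sigma>(2) by (simp add: has_bochner_integral_iff integrable_distr_eq integral_distr)
  have var: "var h = \<sigma>\<^sup>2" unfolding var_def using 2 by (rule has_bochner_integral_integral_eq)
  show "integrable \<mu> (\<lambda>x. (h \<bullet> x)\<^sup>2)" "integrable \<mu> (\<lambda>x. (h \<bullet> x) ^ 4)"
    using 2 4 by (auto simp: has_bochner_integral_iff)
  show "(\<integral>x. (h \<bullet> x) ^ 4 \<partial>\<mu>) = 3 * (var h)\<^sup>2"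
    using 4 by (simp add: has_bochner_integral_iff var flip: power_mult)
  have int: "integrable \<mu> (\<lambda>x. iexp (h \<bullet> x))"
    by (rule integrable_const_bound[where B = 1]) auto
  have char: "(CLINT x|\<mu>. iexp (h \<bullet> x)) = complex_of_real (exp (- var h / 2))"
    using \<sigma>(3)[of 1] by (simp add: char_def integral_distr var)
  show "(\<integral>x. cos (h \<bullet> x) \<partial>\<mu>) = exp (- var h / 2)"
    using arg_cong[OF char, of Re] integral_Re[OF int] by (simp add: Re_exp)
  show "(\<integral>x. sin (h \<bullet> x) \<partial>\<mu>) = 0"
    using arg_cong[OF char, of Im] integral_Im[OF int] by (simp add: Im_exp)
qed

lemma var_nonneg: "0 \<le> var h"
  by (simp add: var_def)

lemma integrable_inner_mult: "integrable \<mu> (\<lambda>x. (g \<bullet> x) * (h \<bullet> x))"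
  by (rule integrable_mult_squares) (simp_all add: integrable_inner_power2)

lemma inner_square_mult_moment:
  shows "integrable \<mu> (\<lambda>x. (g \<bullet> x)\<^sup>2 * (h \<bullet> x)\<^sup>2)"
    and "(\<integral>x. (g \<bullet> x)\<^sup>2 * (h \<bullet> x)\<^sup>2 \<partial>\<mu>) \<le> 3 * var g * var h"
proof -
  have amgm: "a * b \<le> (r * a\<^sup>2 + b\<^sup>2 / r) / 2" if "r > 0" for a b r :: real
  proof -
    have "0 \<le> (r * a - b)\<^sup>2 / r" using that by simp
    also have "\<dots> = r * a\<^sup>2 + b\<^sup>2 / r - 2 * (a * b)"
      using that by (simp add: power2_eq_square field_simps)
    finally show ?thesis by simp
  qed
  have p4: "((x::real)\<^sup>2)\<^sup>2 = x ^ 4" for x by (simp flip: power_mult)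
  show int: "integrable \<mu> (\<lambda>x. (g \<bullet> x)\<^sup>2 * (h \<bullet> x)\<^sup>2)"
  proof (rule Bochner_Integration.integrable_bound)
    show "integrable \<mu> (\<lambda>x. (1 * (g \<bullet> x) ^ 4 + (h \<bullet> x) ^ 4 / 1) / 2)"
      using integrable_inner_power4 by simp
    show "AE x in \<mu>. norm ((g \<bullet> x)\<^sup>2 * (h \<bullet> x)\<^sup>2) \<le> norm ((1 * (g \<bullet> x) ^ 4 + (h \<bullet> x) ^ 4 / 1) / 2)"
      using amgm[of 1 "(g \<bullet> _)\<^sup>2" "(h \<bullet> _)\<^sup>2"] by (intro AE_I2) (simp add: p4)
  qed auto
  have zero: "(\<integral>x. (g \<bullet> x)\<^sup>2 * (h \<bullet> x)\<^sup>2 \<partial>\<mu>) = 0" if "var g = 0" for g h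
  proof -
    have "AE x in \<mu>. (g \<bullet> x)\<^sup>2 = 0"
      using that integral_nonneg_eq_0_iff_AE[OF integrable_inner_power2, of g] by (simp add: var_def)
    then have "AE x in \<mu>. (g \<bullet> x)\<^sup>2 * (h \<bullet> x)\<^sup>2 = 0" by auto
    then show ?thesis by (subst integral_cong_AE[where g = "\<lambda>_. 0"]) auto
  qed
  show "(\<integral>x. (g \<bullet> x)\<^sup>2 * (h \<bullet> x)\<^sup>2 \<partial>\<mu>) \<le> 3 * var g * var h"
  proof (cases "var g = 0 \<or> var h = 0")
    case True
    then show ?thesis using zero[of g h] zero[of h g] by (auto simp: mult.commute)
  next
    case False
    then have pos: "var g > 0" "var h > 0" using var_nonneg by (simp_all add: order_less_le)
    let ?r = "var h / var g"
    have "(\<integral>x. (g \<bullet> x)\<^sup>2 * (h \<bullet> x)\<^sup>2 \<partial>\<mu>) \<le> (\<integral>x. (?r * (g \<bullet> x) ^ 4 + (h \<bullet> x) ^ 4 / ?r) / 2 \<partial>\<mu>)"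
      using amgm[of ?r "(g \<bullet> _)\<^sup>2" "(h \<bullet> _)\<^sup>2"] pos integrable_inner_power4
      by (intro integral_mono int) (simp_all add: p4)
    also have "\<dots> = (?r * (3 * (var g)\<^sup>2) + (3 * (var h)\<^sup>2) / ?r) / 2"
      using integrable_inner_power4 by (simp add: integral_inner_power4)
    also have "\<dots> = 3 * var g * var h"
      using pos by (simp add: power2_eq_square field_simps)
    finally show ?thesis .
  qed
qed

text \<open>The Paley--Zygmund argument: fourth moments control the square of the second, so the
  partial traces cannot outgrow the tail of the almost surely finite norm.\<close>

lemma summable_var_basis:
  assumes "hilbert_basis e"
  shows "summable (\<lambda>k. var (e k))"
proof -
  interpret hilbert_basis e by fact
  define A where "A n = {x::'a. real n < (norm x)\<^sup>2}" for n
  have A [measurable]: "A n \<in> sets \<mu>" for n unfolding A_def by simp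
  have "(\<lambda>n. measure \<mu> (A n)) \<longlonglongrightarrow> measure \<mu> (\<Inter>n. A n)"
    by (rule finite_Lim_measure_decseq) (auto simp: decseq_def A_def)
  moreover have "(\<Inter>n. A n) = {}"
    by (auto simp: A_def) (metis reals_Archimedean2 less_asym)
  ultimately have "\<forall>\<^sub>F n in sequentially. measure \<mu> (A n) < 1 / 12"
    by (intro order_tendstoD) auto
  then obtain m where m: "measure \<mu> (A m) < 1 / 12" by (auto simp: eventually_sequentially)
  have bound: "(\<Sum>k<n. var (e k)) \<le> 2 * m" for n
  proof -
    define S where "S x = (\<Sum>k<n. (e k \<bullet> x)\<^sup>2)" for x
    define T where "T = (\<Sum>k<n. var (e k))"
    have S_le: "S x \<le> (norm x)\<^sup>2" for x
    proof -
      have "S x \<le> (\<Sum>k. (e k \<bullet> x)\<^sup>2)"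
        unfolding S_def by (rule sum_le_suminf) (use parseval[of x x] in \<open>auto simp: power2_eq_square sums_iff\<close>)
      then show ?thesis
        using parseval[of x x] by (simp add: power2_eq_square sums_iff power2_norm_eq_inner[unfolded power2_eq_square])
    qed
    have int_S: "integrable \<mu> S" and S: "(\<integral>x. S x \<partial>\<mu>) = T"
      unfolding S_def T_def var_def using integrable_inner_power2 by simp_all
    have S2_eq: "(S x)\<^sup>2 = (\<Sum>k<n. \<Sum>l<n. (e k \<bullet> x)\<^sup>2 * (e l \<bullet> x)\<^sup>2)" for x
      by (simp add: S_def power2_eq_square sum_product)
    have int_S2: "integrable \<mu> (\<lambda>x. (S x)\<^sup>2)"
      unfolding S2_eq using inner_square_mult_moment(1) by simp
    have "(\<integral>x. (S x)\<^sup>2 \<partial>\<mu>) = (\<Sum>k<n. \<Sum>l<n. \<integral>x. (e k \<bullet> x)\<^sup>2 * (e l \<bullet> x)\<^sup>2 \<partial>\<mu>)"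
      unfolding S2_eq using inner_square_mult_moment(1) by simp
    also have "\<dots> \<le> (\<Sum>k<n. \<Sum>l<n. 3 * var (e k) * var (e l))"
      by (intro sum_mono inner_square_mult_moment(2))
    also have "\<dots> = 3 * T\<^sup>2"
    proof -
      have "T\<^sup>2 = (\<Sum>k<n. \<Sum>l<n. var (e k) * var (e l))"
        by (simp only: T_def power2_eq_square sum_product)
      then show ?thesis by (simp add: sum_distrib_left mult.assoc)
    qed
    finally have S2: "(\<integral>x. (S x)\<^sup>2 \<partial>\<mu>) \<le> 3 * T\<^sup>2" .
    have "T \<ge> 0" by (simp add: T_def sum_nonneg var_nonneg)
    show ?thesis
    proof (cases "T = 0")
      case False
      then have "T > 0" using \<open>T \<ge> 0\<close> by simp
      have pw: "S x \<le> real m + (S x)\<^sup>2 / (12 * T) + 3 * T * indicator (A m) x" for x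
      proof (cases "x \<in> A m")
        case True
        have "0 \<le> (S x - 6 * T)\<^sup>2 / (12 * T)" using \<open>T > 0\<close> by simp
        also have "\<dots> = (S x)\<^sup>2 / (12 * T) + 3 * T - S x"
          using \<open>T > 0\<close> by (simp add: power2_eq_square field_simps)
        finally show ?thesis using True by simp
      next
        case False
        then have "S x \<le> real m" using S_le[of x] by (simp add: A_def)
        moreover have "0 \<le> (S x)\<^sup>2 / (12 * T)" using \<open>T > 0\<close> by simp
        ultimately show ?thesis using False by simp
      qed
      have int_A: "integrable \<mu> (indicator (A m) :: 'a \<Rightarrow> real)"
        using A[of m] by (intro integrable_real_indicator) (simp_all add: emeasure_eq_measure)
      have "T \<le> (\<integral>x. real m + (S x)\<^sup>2 / (12 * T) + 3 * T * indicator (A m) x \<partial>\<mu>)"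
        unfolding S[symmetric] using int_S2 int_A pw
        by (intro integral_mono int_S Bochner_Integration.integrable_add)
           (auto simp: S emeasure_eq_measure)
      also have "\<dots> = real m + (\<integral>x. (S x)\<^sup>2 \<partial>\<mu>) / (12 * T) + 3 * T * measure \<mu> (A m)"
        using int_S2 int_A prob_space by simp
      also have "\<dots> \<le> real m + 3 * T\<^sup>2 / (12 * T) + 3 * T * (1 / 12)"
        using S2 m \<open>T > 0\<close> by (intro add_mono mult_left_mono divide_right_mono) auto
      also have "\<dots> = real m + T / 2" using \<open>T > 0\<close> by (simp add: power2_eq_square field_simps)
      finally show ?thesis by (simp add: T_def)
    qed (simp add: T_def)
  qed
  show ?thesis
    by (rule summableI_nonneg_bounded[where x = "2 * real m"]) (use bound var_nonneg in auto)
qed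

end

section \<open>Uniqueness of characteristic functions\<close>

locale two_prob_spaces = M: prob_space M + N: prob_space N for M N :: "'x measure" +
  assumes sets_eq: "sets M = sets N"
begin

lemma measurable_eq: "measurable M B = measurable N B"
  by (rule measurable_cong_sets[OF sets_eq refl])

lemma measurable_transfer: "f \<in> measurable M B \<Longrightarrow> f \<in> measurable N B"
  by (simp only: measurable_eq)

lemma integral_indicator_eq_if_char_eq:
  fixes f w :: "'x \<Rightarrow> real"
  assumes f [measurable]: "f \<in> borel_measurable M" and w [measurable]: "w \<in> borel_measurable M"
    and A: "A \<in> sets borel"
    and w_bounds: "\<And>x. 0 \<le> w x" "\<And>x. w x \<le> C"
    and cos: "\<And>s. (\<integral>x. w x * cos (s * f x) \<partial>M) = (\<integral>x. w x * cos (s * f x) \<partial>N)"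
    and sin: "\<And>s. (\<integral>x. w x * sin (s * f x) \<partial>M) = (\<integral>x. w x * sin (s * f x) \<partial>N)"
  shows "(\<integral>x. w x * indicator A (f x) \<partial>M) = (\<integral>x. w x * indicator A (f x) \<partial>N)"
proof -
  have fN [measurable]: "f \<in> borel_measurable N" and wN [measurable]: "w \<in> borel_measurable N"
    using f w by (auto intro: measurable_transfer)
  note A [measurable]
  define m where "m = (\<integral>x. w x \<partial>M)"
  have mN: "m = (\<integral>x. w x \<partial>N)" using cos[of 0] by (simp add: m_def)
  have bd: "norm (w x * g x) \<le> C" if "\<bar>g x\<bar> \<le> 1" for x and g :: "'x \<Rightarrow> real"
  proof -
    have "\<bar>w x\<bar> * \<bar>g x\<bar> \<le> C * 1"
      using w_bounds[of x] that by (intro mult_mono) auto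
    then show ?thesis by (simp add: abs_mult)
  qed
  have intM: "integrable M (\<lambda>x. w x * g x)" if "g \<in> borel_measurable M" "\<And>x. \<bar>g x\<bar> \<le> 1" for g
    using that bd by (intro M.integrable_const_bound[where B = C]) auto
  have intN: "integrable N (\<lambda>x. w x * g x)" if "g \<in> borel_measurable N" "\<And>x. \<bar>g x\<bar> \<le> 1" for g
    using that bd by (intro N.integrable_const_bound[where B = C]) auto
  have wM: "integrable M w" and wN': "integrable N w"
    using intM[of "\<lambda>_. 1"] intN[of "\<lambda>_. 1"] by simp_all
  have "m \<ge> 0" unfolding m_def using w_bounds by simp
  show ?thesis
  proof (cases "m = 0")
    case True
    have zM: "AE x in M. w x = 0" using integral_nonneg_eq_0_iff_AE[OF wM] w_bounds True by (simp add: m_def)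
    have zN: "AE x in N. w x = 0" using integral_nonneg_eq_0_iff_AE[OF wN'] w_bounds True by (simp add: mN)
    have "(\<integral>x. w x * indicator A (f x) \<partial>M) = (\<integral>x. 0 \<partial>M)"
      by (rule integral_cong_AE) (use zM in auto)
    moreover have "(\<integral>x. w x * indicator A (f x) \<partial>N) = (\<integral>x. 0 \<partial>N)"
      by (rule integral_cong_AE) (use zN in auto)
    ultimately show ?thesis by simp
  next
    case False
    then have "m > 0" using \<open>m \<ge> 0\<close> by simp
    define D where "D P = distr (density P (\<lambda>x. ennreal (w x / m))) borel f" for P
    have key: "real_distribution (D P) \<and> (\<forall>s. char (D P) s = Complex ((\<integral>x. w x * cos (s * f x) \<partial>P) / m) ((\<integral>x. w x * sin (s * f x) \<partial>P) / m))
        \<and> measure (D P) A = (\<integral>x. w x * indicator A (f x) \<partial>P) / m"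
      if P: "prob_space P" "sets P = sets M" "(\<integral>x. w x \<partial>P) = m" for P
    proof -
      interpret P: prob_space P by fact
      have fP [measurable]: "f \<in> borel_measurable P" and wP [measurable]: "w \<in> borel_measurable P"
        using f w by (simp_all only: measurable_cong_sets[OF P(2) refl])
      have intP: "integrable P (\<lambda>x. w x * g x)" if "g \<in> borel_measurable P" "\<And>x. \<bar>g x\<bar> \<le> 1" for g
        using that bd by (intro P.integrable_const_bound[where B = C]) auto
      have intw: "integrable P w" using intP[of "\<lambda>_. 1"] by simp
      have nn: "0 \<le> w x / m" for x using w_bounds[of x] \<open>m > 0\<close> by simp
      have "emeasure (density P (\<lambda>x. ennreal (w x / m))) (space P) = ennreal (\<integral>x. w x / m \<partial>P)"
        using intw nn by (simp add: emeasure_density nn_integral_eq_integral cong: nn_integral_cong_simp)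
      also have "\<dots> = 1" using P(3) \<open>m > 0\<close> by simp
      finally have ps: "prob_space (density P (\<lambda>x. ennreal (w x / m)))"
        by (intro prob_spaceI) simp
      then have "real_distribution (D P)"
        unfolding D_def by (intro prob_space.real_distribution_distr) auto
      moreover have "char (D P) s = Complex ((\<integral>x. w x * cos (s * f x) \<partial>P) / m) ((\<integral>x. w x * sin (s * f x) \<partial>P) / m)" for s
      proof -
        have "char (D P) s = (CLINT x|P. (w x / m) *\<^sub>R iexp (s * f x))"
          unfolding char_def D_def using nn
          by (simp add: integral_distr integral_density)
        moreover have int: "integrable P (\<lambda>x. (w x / m) *\<^sub>R iexp (s * f x))"
          by (rule P.integrable_const_bound[where B = "C / m"])
            (use w_bounds \<open>m > 0\<close> in \<open>auto simp: abs_mult divide_right_mono\<close>)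
        ultimately show ?thesis
          using integral_Re[OF int] integral_Im[OF int]
          by (intro complex_eqI) (simp_all add: Re_exp Im_exp)
      qed
      moreover have "measure (D P) A = (\<integral>x. w x * indicator A (f x) \<partial>P) / m"
      proof -
        have "emeasure (D P) A = (\<integral>\<^sup>+x. ennreal (w x / m) * indicator (f -` A \<inter> space P) x \<partial>P)"
          unfolding D_def by (simp add: emeasure_distr emeasure_density)
        also have "\<dots> = (\<integral>\<^sup>+x. ennreal (w x * indicator A (f x) / m) \<partial>P)"
          by (rule nn_integral_cong) (auto split: split_indicator)
        also have "\<dots> = ennreal ((\<integral>x. w x * indicator A (f x) \<partial>P) / m)"
          using intP[of "\<lambda>x. indicator A (f x)"] w_bounds \<open>m > 0\<close>
          by (subst nn_integral_eq_integral) (auto simp: indicator_def)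
        finally show ?thesis using w_bounds \<open>m > 0\<close> by (simp add: measure_def)
      qed
      ultimately show ?thesis by blast
    qed
    note kM = key[OF M.prob_space_axioms refl m_def[symmetric]]
      and kN = key[OF N.prob_space_axioms sets_eq[symmetric] mN[symmetric]]
    have "char (D M) = char (D N)" using kM kN cos sin by (intro ext) simp
    then have "D M = D N" using kM kN Levy_uniqueness by blast
    then show ?thesis using kM kN \<open>m > 0\<close> by simp
  qed
qed

definition trig_agree :: "('x \<Rightarrow> real) set \<Rightarrow> ('x \<Rightarrow> real) \<Rightarrow> bool" where
  "trig_agree V w \<longleftrightarrow> (\<forall>\<theta>\<in>V. (\<integral>x. w x * cos (\<theta> x) \<partial>M) = (\<integral>x. w x * cos (\<theta> x) \<partial>N) \<and>
     (\<integral>x. w x * sin (\<theta> x) \<partial>M) = (\<integral>x. w x * sin (\<theta> x) \<partial>N))"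

context
  fixes V :: "('x \<Rightarrow> real) set"
  assumes V_measurable: "\<And>f. f \<in> V \<Longrightarrow> f \<in> borel_measurable M"
    and V_add: "\<And>f g. f \<in> V \<Longrightarrow> g \<in> V \<Longrightarrow> (\<lambda>x. f x + g x) \<in> V"
    and V_scale: "\<And>f r. f \<in> V \<Longrightarrow> (\<lambda>x. r * f x) \<in> V"
begin

text \<open>Fourier inversion in the direction \<open>f\<close> only, applied to the non-negative weights
  \<open>w (1 + cos \<theta>)\<close> and \<open>w (1 + sin \<theta>)\<close>.\<close>

lemma trig_agree_indicator:
  assumes w [measurable]: "w \<in> borel_measurable M" and w01: "\<And>x. 0 \<le> w x" "\<And>x. w x \<le> 1"
    and agree: "trig_agree V w" and fV: "f \<in> V" and A: "A \<in> sets borel"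
  shows "trig_agree V (\<lambda>x. w x * indicator A (f x))"
  unfolding trig_agree_def
proof
  fix \<theta> assume \<theta>V: "\<theta> \<in> V"
  note A [measurable]
  have [measurable]: "f \<in> borel_measurable M" "\<theta> \<in> borel_measurable M" "w \<in> borel_measurable M"
    using V_measurable fV \<theta>V w by auto
  then have [measurable]: "f \<in> borel_measurable N" "\<theta> \<in> borel_measurable N" "w \<in> borel_measurable N"
    by (auto intro: measurable_transfer)
  have bd: "norm (w x * g x) \<le> 1" if "\<bar>g x\<bar> \<le> 1" for x and g :: "'x \<Rightarrow> real"
    using w01[of x] that by (simp add: abs_mult mult_le_one)
  have intM: "integrable M (\<lambda>x. w x * g x)" if "g \<in> borel_measurable M" "\<And>x. \<bar>g x\<bar> \<le> 1" for g
    using that bd by (intro M.integrable_const_bound[where B = 1]) auto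
  have intN: "integrable N (\<lambda>x. w x * g x)" if "g \<in> borel_measurable N" "\<And>x. \<bar>g x\<bar> \<le> 1" for g
    using that bd by (intro N.integrable_const_bound[where B = 1]) auto
  have comb: "(\<lambda>x. s * f x + r * \<theta> x) \<in> V" for s r
    by (intro V_add V_scale fV \<theta>V)
  have c: "(\<integral>x. w x * cos (s * f x + r * \<theta> x) \<partial>M) = (\<integral>x. w x * cos (s * f x + r * \<theta> x) \<partial>N)"
    and s: "(\<integral>x. w x * sin (s * f x + r * \<theta> x) \<partial>M) = (\<integral>x. w x * sin (s * f x + r * \<theta> x) \<partial>N)" for s r
    using agree comb[of s r] by (auto simp: trig_agree_def)
  have half: "(\<integral>x. w x * (a x + (b x + r * d x) / 2) \<partial>M) = (\<integral>x. w x * (a x + (b x + r * d x) / 2) \<partial>N)"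
    if "a \<in> borel_measurable M" "b \<in> borel_measurable M" "d \<in> borel_measurable M"
      "\<And>x. \<bar>a x\<bar> \<le> 1" "\<And>x. \<bar>b x\<bar> \<le> 1" "\<And>x. \<bar>d x\<bar> \<le> 1"
      "(\<integral>x. w x * a x \<partial>M) = (\<integral>x. w x * a x \<partial>N)"
      "(\<integral>x. w x * b x \<partial>M) = (\<integral>x. w x * b x \<partial>N)"
      "(\<integral>x. w x * d x \<partial>M) = (\<integral>x. w x * d x \<partial>N)" for a b d and r :: real
  proof -
    have eq: "w x * (a x + (b x + r * d x) / 2) = w x * a x + (w x * b x) / 2 + (r / 2) * (w x * d x)" for x
      by (simp add: field_simps)
    have iM: "integrable M (\<lambda>x. w x * a x)" "integrable M (\<lambda>x. w x * b x)" "integrable M (\<lambda>x. w x * d x)"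
      using intM[OF that(1,4)] intM[OF that(2,5)] intM[OF that(3,6)] by auto
    have iN: "integrable N (\<lambda>x. w x * a x)" "integrable N (\<lambda>x. w x * b x)" "integrable N (\<lambda>x. w x * d x)"
      using intN[OF measurable_transfer[OF that(1)] that(4)] intN[OF measurable_transfer[OF that(2)] that(5)]
        intN[OF measurable_transfer[OF that(3)] that(6)] by auto
    show ?thesis unfolding eq using iM iN that(7-9) by simp
  qed
  have cos_cos: "cos a * cos b = (cos (a + b) + cos (a - b)) / 2" for a b :: real
    by (simp add: cos_add cos_diff)
  have cos_sin: "cos a * sin b = (sin (a + b) - sin (a - b)) / 2" for a b :: real
    by (simp add: sin_add sin_diff)
  have sin_cos: "sin a * cos b = (sin (a + b) + sin (a - b)) / 2" for a b :: real
    by (simp add: sin_add sin_diff)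
  have sin_sin: "sin a * sin b = (cos (a - b) - cos (a + b)) / 2" for a b :: real
    by (simp add: cos_add cos_diff)
  have base: "(\<integral>x. w x * indicator A (f x) \<partial>M) = (\<integral>x. w x * indicator A (f x) \<partial>N)"
    by (rule integral_indicator_eq_if_char_eq[where C = 1]) (use w01 A c[of _ 0] s[of _ 0] in auto)
  have "(\<integral>x. (w x * (1 + cos (\<theta> x))) * indicator A (f x) \<partial>M) = (\<integral>x. (w x * (1 + cos (\<theta> x))) * indicator A (f x) \<partial>N)"
  proof (rule integral_indicator_eq_if_char_eq[where C = 2])
    fix t
    have 1: "w x * (1 + cos (\<theta> x)) * cos (t * f x) = w x * (cos (t * f x) + (cos (t * f x + 1 * \<theta> x) + 1 * cos (t * f x + (-1) * \<theta> x)) / 2)" for x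
    proof -
      have "w x * (1 + cos (\<theta> x)) * cos (t * f x) = w x * (cos (t * f x) + cos (t * f x) * cos (\<theta> x))"
        by (simp add: algebra_simps)
      then show ?thesis by (simp add: cos_cos)
    qed
    have 2: "w x * (1 + cos (\<theta> x)) * sin (t * f x) = w x * (sin (t * f x) + (sin (t * f x + 1 * \<theta> x) + 1 * sin (t * f x + (-1) * \<theta> x)) / 2)" for x
    proof -
      have "w x * (1 + cos (\<theta> x)) * sin (t * f x) = w x * (sin (t * f x) + sin (t * f x) * cos (\<theta> x))"
        by (simp add: algebra_simps)
      then show ?thesis by (simp add: sin_cos)
    qed
    show "(\<integral>x. w x * (1 + cos (\<theta> x)) * cos (t * f x) \<partial>M) = (\<integral>x. w x * (1 + cos (\<theta> x)) * cos (t * f x) \<partial>N)"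
      unfolding 1 by (rule half) (use c[of t 1] c[of t "-1"] c[of t 0] in auto)
    show "(\<integral>x. w x * (1 + cos (\<theta> x)) * sin (t * f x) \<partial>M) = (\<integral>x. w x * (1 + cos (\<theta> x)) * sin (t * f x) \<partial>N)"
      unfolding 2 by (rule half) (use s[of t 1] s[of t "-1"] s[of t 0] in auto)
  next
    fix x
    have b: "0 \<le> 1 + cos (\<theta> x)" "1 + cos (\<theta> x) \<le> 2"
      using cos_ge_minus_one[of "\<theta> x"] cos_le_one[of "\<theta> x"] by linarith+
    show "0 \<le> w x * (1 + cos (\<theta> x))" by (rule mult_nonneg_nonneg[OF w01(1) b(1)])
    show "w x * (1 + cos (\<theta> x)) \<le> 2" using mult_mono[OF w01(2)[of x] b(2)] b(1) by simp
  qed (use A in auto)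
  moreover have "(\<integral>x. (w x * (1 + sin (\<theta> x))) * indicator A (f x) \<partial>M) = (\<integral>x. (w x * (1 + sin (\<theta> x))) * indicator A (f x) \<partial>N)"
  proof (rule integral_indicator_eq_if_char_eq[where C = 2])
    fix t
    have 1: "w x * (1 + sin (\<theta> x)) * cos (t * f x) = w x * (cos (t * f x) + (sin (t * f x + 1 * \<theta> x) + (-1) * sin (t * f x + (-1) * \<theta> x)) / 2)" for x
    proof -
      have "w x * (1 + sin (\<theta> x)) * cos (t * f x) = w x * (cos (t * f x) + cos (t * f x) * sin (\<theta> x))"
        by (simp add: algebra_simps)
      then show ?thesis by (simp add: cos_sin)
    qed
    have 2: "w x * (1 + sin (\<theta> x)) * sin (t * f x) = w x * (sin (t * f x) + (cos (t * f x + (-1) * \<theta> x) + (-1) * cos (t * f x + 1 * \<theta> x)) / 2)" for x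
    proof -
      have "w x * (1 + sin (\<theta> x)) * sin (t * f x) = w x * (sin (t * f x) + sin (t * f x) * sin (\<theta> x))"
        by (simp add: algebra_simps)
      then show ?thesis by (simp add: sin_sin)
    qed
    show "(\<integral>x. w x * (1 + sin (\<theta> x)) * cos (t * f x) \<partial>M) = (\<integral>x. w x * (1 + sin (\<theta> x)) * cos (t * f x) \<partial>N)"
      unfolding 1 by (rule half) (use s[of t 1] s[of t "-1"] c[of t 0] in auto)
    show "(\<integral>x. w x * (1 + sin (\<theta> x)) * sin (t * f x) \<partial>M) = (\<integral>x. w x * (1 + sin (\<theta> x)) * sin (t * f x) \<partial>N)"
      unfolding 2 by (rule half) (use c[of t 1] c[of t "-1"] s[of t 0] in auto)
  next
    fix x
    have b: "0 \<le> 1 + sin (\<theta> x)" "1 + sin (\<theta> x) \<le> 2"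
      using sin_ge_minus_one[of "\<theta> x"] sin_le_one[of "\<theta> x"] by linarith+
    show "0 \<le> w x * (1 + sin (\<theta> x))" by (rule mult_nonneg_nonneg[OF w01(1) b(1)])
    show "w x * (1 + sin (\<theta> x)) \<le> 2" using mult_mono[OF w01(2)[of x] b(2)] b(1) by simp
  qed (use A in auto)
  moreover have split: "(\<integral>x. (w x * (1 + g x)) * indicator A (f x) \<partial>P)
      = (\<integral>x. w x * indicator A (f x) \<partial>P) + (\<integral>x. w x * indicator A (f x) * g x \<partial>P)"
    if "P = M \<or> P = N" "g \<in> borel_measurable M" "\<And>x. \<bar>g x\<bar> \<le> 1" for g P
  proof -
    have eq: "(w x * (1 + g x)) * indicator A (f x) = w x * indicator A (f x) + w x * (indicator A (f x) * g x)" for x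
      by (simp add: algebra_simps)
    have "\<bar>indicator A (f x)\<bar> \<le> (1::real)" "\<bar>indicator A (f x) * g x\<bar> \<le> 1" for x
      using that(3)[of x] by (auto simp: indicator_def)
    moreover have [measurable]: "g \<in> borel_measurable M" "g \<in> borel_measurable N"
      using that(2) by (auto intro: measurable_transfer)
    ultimately have "integrable P (\<lambda>x. w x * indicator A (f x))" "integrable P (\<lambda>x. w x * (indicator A (f x) * g x))"
      using that(1) intM[of "\<lambda>x. indicator A (f x)"] intN[of "\<lambda>x. indicator A (f x)"]
        intM[of "\<lambda>x. indicator A (f x) * g x"] intN[of "\<lambda>x. indicator A (f x) * g x"] by auto
    then show ?thesis unfolding eq by (simp add: mult.assoc)
  qed
  ultimately show "(\<integral>x. w x * indicator A (f x) * cos (\<theta> x) \<partial>M) = (\<integral>x. w x * indicator A (f x) * cos (\<theta> x) \<partial>N) \<and>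
      (\<integral>x. w x * indicator A (f x) * sin (\<theta> x) \<partial>M) = (\<integral>x. w x * indicator A (f x) * sin (\<theta> x) \<partial>N)"
    using base split[of M "\<lambda>x. cos (\<theta> x)"] split[of N "\<lambda>x. cos (\<theta> x)"]
      split[of M "\<lambda>x. sin (\<theta> x)"] split[of N "\<lambda>x. sin (\<theta> x)"] by simp
qed

lemma cylinder_measure_eq:
  fixes f :: "'i \<Rightarrow> 'x \<Rightarrow> real" and A :: "'i \<Rightarrow> real set"
  assumes char: "trig_agree V (\<lambda>_. 1)" and "finite I" "\<And>i. i \<in> I \<Longrightarrow> f i \<in> V" "\<And>i. i \<in> I \<Longrightarrow> A i \<in> sets borel"
    and "V \<noteq> {}"
  shows "measure M {x \<in> space M. \<forall>i\<in>I. f i x \<in> A i} = measure N {x \<in> space N. \<forall>i\<in>I. f i x \<in> A i}"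
proof -
  define w :: "'i set \<Rightarrow> 'x \<Rightarrow> real" where "w J x = (\<Prod>i\<in>J. indicator (A i) (f i x))" for J x
  have w01: "0 \<le> w J x" "w J x \<le> 1" for J x
    by (auto simp: w_def intro!: prod_nonneg prod_le_1)
  have meas: "w J \<in> borel_measurable M" if "J \<subseteq> I" for J
    unfolding w_def using assms(3,4) V_measurable that
    by (intro borel_measurable_prod borel_measurable_indicator' measurable_sets) (auto simp: subset_iff)
  have "trig_agree V (w J)" if "J \<subseteq> I" for J
    using finite_subset[OF that \<open>finite I\<close>] that
  proof (induction J rule: finite_induct)
    case empty
    then show ?case using char by (simp add: w_def)
  next
    case (insert i J)
    have "w (insert i J) = (\<lambda>x. w J x * indicator (A i) (f i x))"
      using insert.hyps by (auto simp: w_def mult.commute)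
    then show ?case
      using trig_agree_indicator[OF meas w01 insert.IH, of "f i" "A i"] insert.prems assms(3,4) by auto
  qed
  from this[OF order_refl] have agree: "trig_agree V (w I)" .
  obtain g where "g \<in> V" using \<open>V \<noteq> {}\<close> by blast
  then have zero: "(\<lambda>x. 0) \<in> V" using V_scale[of g 0] by simp
  have w_ind: "w I x = indicator {x. \<forall>i\<in>I. f i x \<in> A i} x" for x
    using \<open>finite I\<close> by (auto simp: w_def indicator_def prod_zero_iff)
  have "(\<integral>x. w I x \<partial>P) = measure P {x \<in> space P. \<forall>i\<in>I. f i x \<in> A i}" for P
  proof -
    have "(\<integral>x. w I x \<partial>P) = (\<integral>x. indicator {x \<in> space P. \<forall>i\<in>I. f i x \<in> A i} x \<partial>P)"
      by (rule Bochner_Integration.integral_cong) (auto simp: w_ind indicator_def)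
    then show ?thesis by (simp add: Int_def conj_ac)
  qed
  moreover have "(\<integral>x. w I x \<partial>M) = (\<integral>x. w I x \<partial>N)"
    using bspec[OF agree[unfolded trig_agree_def] zero] by simp
  ultimately show ?thesis by simp
qed

end

end

context hilbert_basis
begin

lemma sets_borel_eq_cylinders:
  "sets borel = sigma_sets UNIV {{x. \<forall>k<n. e k \<bullet> x \<in> A k} | n A. \<forall>k::nat. A k \<in> sets (borel :: real measure)}"
    (is "_ = sigma_sets _ ?E")
proof
  have "{x. \<forall>k<n. e k \<bullet> x \<in> A k} \<in> sets borel" if "\<forall>k. A k \<in> sets (borel :: real measure)" for n :: nat and A
  proof -
    have "{x \<in> space borel. \<forall>k\<in>{..<n}. e k \<bullet> x \<in> A k} \<in> sets borel"
    proof (rule sets.sets_Collect_finite_All)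
      fix k
      have "(\<lambda>x. e k \<bullet> x) -` A k \<inter> space borel \<in> sets borel"
        by (rule measurable_sets[of _ borel borel]) (use that in auto)
      then show "{x \<in> space borel. e k \<bullet> x \<in> A k} \<in> sets borel" by (simp add: vimage_def Int_def)
    qed simp
    then show ?thesis by (simp only: lessThan_iff Ball_def space_borel UNIV_I simp_thms)
  qed
  then have "?E \<subseteq> sets borel" by blast
  then show "sigma_sets UNIV ?E \<subseteq> sets borel"
    using sets.sigma_sets_subset[of ?E borel] by (simp only: space_borel)
next
  define S where "S = sigma (UNIV :: 'a set) ?E"
  have S: "sets S = sigma_sets UNIV ?E" "space S = UNIV" by (simp_all add: S_def)
  have coord: "(\<lambda>x. e k \<bullet> x) \<in> borel_measurable S" for k
  proof (rule measurableI)
    fix A :: "real set" assume "A \<in> sets borel"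
    then have "{x. \<forall>j<Suc k. e j \<bullet> x \<in> (if j = k then A else UNIV)} \<in> ?E"
      by (intro CollectI exI[of _ "Suc k"] exI[of _ "\<lambda>j. if j = k then A else UNIV"]) auto
    moreover have "{x. \<forall>j<Suc k. e j \<bullet> x \<in> (if j = k then A else UNIV)} = (\<lambda>x. e k \<bullet> x) -` A \<inter> space S"
      by (auto simp: S)
    ultimately show "(\<lambda>x. e k \<bullet> x) -` A \<inter> space S \<in> sets S" by (auto simp: S)
  qed simp
  have "(\<lambda>x. x) \<in> borel_measurable S"
  proof (rule borel_measurable_LIMSEQ_metric)
    show "(\<lambda>x. \<Sum>k<n. (e k \<bullet> x) *\<^sub>R e k) \<in> borel_measurable S" for n
      using coord by (intro borel_measurable_sum borel_measurable_scaleR) auto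
    show "(\<lambda>n. \<Sum>k<n. (e k \<bullet> x) *\<^sub>R e k) \<longlonglongrightarrow> x" for x
      using expansion[of x] by (simp add: sums_def)
  qed
  then show "sets borel \<subseteq> sigma_sets UNIV ?E"
    using measurable_sets[of "\<lambda>x. x" S borel] by (auto simp: S)
qed

theorem measure_eq_if_char_eq:
  fixes \<mu> \<nu> :: "'a measure"
  assumes "prob_space \<mu>" "prob_space \<nu>" and sets: "sets \<mu> = sets borel" "sets \<nu> = sets borel"
    and cos: "\<And>h. h \<in> span (range e) \<Longrightarrow> (\<integral>x. cos (h \<bullet> x) \<partial>\<mu>) = (\<integral>x. cos (h \<bullet> x) \<partial>\<nu>)"
    and sin: "\<And>h. h \<in> span (range e) \<Longrightarrow> (\<integral>x. sin (h \<bullet> x) \<partial>\<mu>) = (\<integral>x. sin (h \<bullet> x) \<partial>\<nu>)"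
  shows "\<mu> = \<nu>"
proof -
  interpret two_prob_spaces \<mu> \<nu>
    using assms(1-4) by (intro two_prob_spaces.intro two_prob_spaces_axioms.intro) auto
  have sp: "space \<mu> = UNIV" "space \<nu> = UNIV" using sets_eq_imp_space_eq[OF sets(1)] sets_eq_imp_space_eq[OF sets(2)] by auto
  let ?V = "{\<lambda>x. h \<bullet> x | h. h \<in> span (range e)}"
  let ?E = "{{x. \<forall>k<n. e k \<bullet> x \<in> A k} | n A. \<forall>k::nat. A k \<in> sets (borel :: real measure)}"
  have V: "f \<in> ?V \<Longrightarrow> f \<in> borel_measurable \<mu>"
    "f \<in> ?V \<Longrightarrow> g \<in> ?V \<Longrightarrow> (\<lambda>x. f x + g x) \<in> ?V" "f \<in> ?V \<Longrightarrow> (\<lambda>x. r * f x) \<in> ?V" for f g r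
  proof -
    show "f \<in> ?V \<Longrightarrow> f \<in> borel_measurable \<mu>"
      unfolding measurable_cong_sets[OF sets(1) refl] by auto
    show "(\<lambda>x. f x + g x) \<in> ?V" if fg: "f \<in> ?V" "g \<in> ?V"
    proof -
      obtain a b where "f = (\<lambda>x. a \<bullet> x)" "g = (\<lambda>x. b \<bullet> x)" "a \<in> span (range e)" "b \<in> span (range e)"
        using fg by auto
      then show ?thesis
        by (intro CollectI exI[of _ "a + b"]) (auto simp: inner_add_left span_add)
    qed
    show "(\<lambda>x. r * f x) \<in> ?V" if f: "f \<in> ?V"
    proof -
      obtain a where "f = (\<lambda>x. a \<bullet> x)" "a \<in> span (range e)" using f by auto
      then show ?thesis
        by (intro CollectI exI[of _ "r *\<^sub>R a"]) (auto simp: span_scale)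
    qed
  qed
  have agree: "trig_agree ?V (\<lambda>_. 1)"
    unfolding trig_agree_def using cos sin by auto
  show ?thesis
  proof (rule measure_eqI_generator_eq[where E = ?E and \<Omega> = UNIV and A = "\<lambda>_. UNIV"])
    show "Int_stable ?E"
    proof (rule Int_stableI, safe)
      fix n m :: nat and A B :: "nat \<Rightarrow> real set"
      assume AB: "\<forall>k. A k \<in> sets borel" "\<forall>k. B k \<in> sets borel"
      let ?C = "\<lambda>k. (if k < n then A k else UNIV) \<inter> (if k < m then B k else UNIV)"
      have "{x. \<forall>k<n. e k \<bullet> x \<in> A k} \<inter> {x. \<forall>k<m. e k \<bullet> x \<in> B k} = {x. \<forall>k<max n m. e k \<bullet> x \<in> ?C k}"
        by (auto simp: less_max_iff_disj)
      moreover have "\<forall>k. ?C k \<in> sets borel" using AB by auto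
      ultimately show "\<exists>na Aa. {x. \<forall>k<n. e k \<bullet> x \<in> A k} \<inter> {x. \<forall>k<m. e k \<bullet> x \<in> B k} = {x. \<forall>k<na. e k \<bullet> x \<in> Aa k} \<and> (\<forall>k. Aa k \<in> sets borel)"
        by (intro exI[of _ "max n m"] exI[of _ ?C] conjI)
    qed
    show "sets \<mu> = sigma_sets UNIV ?E" "sets \<nu> = sigma_sets UNIV ?E"
      using sets sets_borel_eq_cylinders by simp_all
    fix X assume "X \<in> ?E"
    then obtain n :: nat and A where X: "X = {x. \<forall>k<n. e k \<bullet> x \<in> A k}" and A: "\<And>k. A k \<in> sets borel" by auto
    have "(\<lambda>x. e k \<bullet> x) \<in> ?V" for k using span_base[of "e k" "range e"] by blast
    then have "measure \<mu> {x \<in> space \<mu>. \<forall>k\<in>{..<n}. e k \<bullet> x \<in> A k} = measure \<nu> {x \<in> space \<nu>. \<forall>k\<in>{..<n}. e k \<bullet> x \<in> A k}"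
      using A by (intro cylinder_measure_eq[OF V agree, where f = "\<lambda>k x. e k \<bullet> x"]) auto
    then show "emeasure \<mu> X = emeasure \<nu> X"
      by (simp add: M.emeasure_eq_measure N.emeasure_eq_measure X sp Ball_def)
  next
    show "range (\<lambda>_. UNIV) \<subseteq> ?E"
      by (auto intro!: exI[of _ 0])
  qed (simp_all add: M.emeasure_eq_measure sp)
qed

end

section \<open>White noise\<close>

definition white_noise :: "(nat \<Rightarrow> real) measure" where
  "white_noise = PiM UNIV (\<lambda>_. std_normal_distribution)"

interpretation white_noise: prob_space white_noise
  unfolding white_noise_def by (intro prob_space_PiM prob_space_normal_density) simp

lemma distr_white_noise_component: "distr white_noise borel (\<lambda>\<omega>. \<omega> n) = std_normal_distribution"
proof -
  have "distr white_noise borel (\<lambda>\<omega>. \<omega> n) = distr white_noise std_normal_distribution (\<lambda>\<omega>. \<omega> n)"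
    by (rule distr_cong) auto
  also have "\<dots> = std_normal_distribution"
    unfolding white_noise_def
    by (rule distr_PiM_component) (auto intro: prob_space_normal_density)
  finally show ?thesis .
qed

lemma measurable_white_noise_component [measurable]: "(\<lambda>\<omega>. \<omega> n) \<in> borel_measurable white_noise"
proof -
  have "(\<lambda>\<omega>. \<omega> n) \<in> measurable white_noise std_normal_distribution"
    unfolding white_noise_def by (rule measurable_component_singleton) simp
  then show ?thesis by simp
qed

lemma indep_white_noise: "white_noise.indep_vars (\<lambda>_. borel) (\<lambda>n \<omega>. \<omega> n) (UNIV :: nat set)"
proof (subst white_noise.indep_vars_iff_distr_eq_PiM')
  have sets: "sets (PiM UNIV (\<lambda>_::nat. borel :: real measure)) = sets white_noise"
    unfolding white_noise_def by (rule sets_PiM_cong) auto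
  have "distr white_noise (PiM UNIV (\<lambda>_. borel)) (\<lambda>\<omega>. \<lambda>n\<in>UNIV. \<omega> n) = distr white_noise white_noise (\<lambda>\<omega>. \<omega>)"
    by (rule distr_cong) (auto simp: sets)
  also have "\<dots> = PiM UNIV (\<lambda>n. distr white_noise borel (\<lambda>\<omega>. \<omega> n))"
    unfolding distr_white_noise_component by (simp add: white_noise_def)
  finally show "distr white_noise (PiM UNIV (\<lambda>_. borel)) (\<lambda>\<omega>. \<lambda>n\<in>UNIV. \<omega> n)
      = PiM UNIV (\<lambda>n. distr white_noise borel (\<lambda>\<omega>. \<omega> n))" .
qed auto

lemma white_noise_covariance:
  shows "integrable white_noise (\<lambda>\<omega>. \<omega> m * \<omega> n)"
    and "(\<integral>\<omega>. \<omega> m * \<omega> n \<partial>white_noise) = (if m = n then 1 else 0)"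
proof -
  have i1: "integrable white_noise (\<lambda>\<omega>. \<omega> n)" and e1: "(\<integral>\<omega>. \<omega> n \<partial>white_noise) = 0" for n
  proof -
    have "has_bochner_integral std_normal_distribution (\<lambda>x. x) 0"
      using std_normal_moment_odd[of 0] by (intro has_bochner_integral_density) auto
    then show "integrable white_noise (\<lambda>\<omega>. \<omega> n)" "(\<integral>\<omega>. \<omega> n \<partial>white_noise) = 0"
      by (simp_all add: has_bochner_integral_iff integrable_distr_eq integral_distr
          flip: distr_white_noise_component[of n])
  qed
  have 2: "integrable white_noise (\<lambda>\<omega>. (\<omega> n)\<^sup>2)" "(\<integral>\<omega>. (\<omega> n)\<^sup>2 \<partial>white_noise) = 1" for n
  proof -
    have "has_bochner_integral std_normal_distribution (\<lambda>x. x\<^sup>2) 1"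
      using std_normal_moment_even[of 1] by (intro has_bochner_integral_density) (auto simp: fact_numeral)
    then show "integrable white_noise (\<lambda>\<omega>. (\<omega> n)\<^sup>2)" "(\<integral>\<omega>. (\<omega> n)\<^sup>2 \<partial>white_noise) = 1"
      by (simp_all add: has_bochner_integral_iff integrable_distr_eq integral_distr
          flip: distr_white_noise_component[of n])
  qed
  have "integrable white_noise (\<lambda>\<omega>. \<omega> m * \<omega> n) \<and> (\<integral>\<omega>. \<omega> m * \<omega> n \<partial>white_noise) = (if m = n then 1 else 0)"
  proof (cases "m = n")
    case True
    then show ?thesis using 2[of n] by (simp add: power2_eq_square)
  next
    case False
    have indep: "white_noise.indep_vars (\<lambda>_. borel) (\<lambda>n \<omega>. \<omega> n) {m, n}"
      by (rule white_noise.indep_vars_subset[OF indep_white_noise]) simp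
    show ?thesis
      using white_noise.indep_vars_integrable[OF _ indep i1]
        white_noise.indep_vars_lebesgue_integral[OF _ indep i1] e1 False by simp
  qed
  then show "integrable white_noise (\<lambda>\<omega>. \<omega> m * \<omega> n)"
    and "(\<integral>\<omega>. \<omega> m * \<omega> n \<partial>white_noise) = (if m = n then 1 else 0)" by auto
qed

definition isonormal :: "finseq \<Rightarrow> (nat \<Rightarrow> real) \<Rightarrow> real" where
  "isonormal x \<omega> = (\<Sum>n. coord x n * \<omega> n)"

lemma isonormal_add: "isonormal (x + y) \<omega> = isonormal x \<omega> + isonormal y \<omega>"
  unfolding isonormal_def plus_finseq.rep_eq distrib_right
  by (rule suminf_add[symmetric]) (rule summable_coord_mult)+

lemma isonormal_scaleR: "isonormal (r *\<^sub>R x) \<omega> = r * isonormal x \<omega>"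
  unfolding isonormal_def scaleR_finseq.rep_eq mult.assoc
  by (rule suminf_mult) (rule summable_coord_mult)

lemma linear_isonormal: "linear (\<lambda>x. isonormal x \<omega>)"
  by (rule linearI) (simp_all add: isonormal_add isonormal_scaleR)

lemma coord_bounded_support:
  obtains N where "\<And>n. n \<ge> N \<Longrightarrow> coord x n = 0"
proof -
  obtain N where "\<forall>n\<in>{n. coord x n \<noteq> 0}. n < N"
    using finite_coord[of x] finite_nat_set_iff_bounded by blast
  then show ?thesis using that[of N] by (metis mem_Collect_eq not_less)
qed

lemma isonormal_eq_sum: "(\<And>n. n \<ge> N \<Longrightarrow> coord x n = 0) \<Longrightarrow> isonormal x \<omega> = (\<Sum>n<N. coord x n * \<omega> n)"
  unfolding isonormal_def by (rule suminf_finite) (auto simp: not_less)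

lemma measurable_isonormal [measurable]: "isonormal x \<in> borel_measurable white_noise"
proof -
  obtain N where "\<And>n. n \<ge> N \<Longrightarrow> coord x n = 0" using coord_bounded_support[of x] by blast
  then have "isonormal x = (\<lambda>\<omega>. \<Sum>n<N. coord x n * \<omega> n)" by (simp add: isonormal_eq_sum fun_eq_iff)
  then show ?thesis by simp
qed

lemma isonormal_covariance:
  shows "integrable white_noise (\<lambda>\<omega>. isonormal x \<omega> * isonormal y \<omega>)"
    and "(\<integral>\<omega>. isonormal x \<omega> * isonormal y \<omega> \<partial>white_noise) = x \<bullet> y"
proof -
  obtain N M where N: "\<And>n. n \<ge> N \<Longrightarrow> coord x n = 0" and M: "\<And>n. n \<ge> M \<Longrightarrow> coord y n = 0"
    using coord_bounded_support[of x] coord_bounded_support[of y] by metis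
  have xN: "isonormal x \<omega> = (\<Sum>n<N. coord x n * \<omega> n)" for \<omega> using N by (rule isonormal_eq_sum)
  have yM: "isonormal y \<omega> = (\<Sum>n<M. coord y n * \<omega> n)" for \<omega> using M by (rule isonormal_eq_sum)
  have eq: "isonormal x \<omega> * isonormal y \<omega> = (\<Sum>m<N. \<Sum>n<M. (coord x m * coord y n) * (\<omega> m * \<omega> n))" for \<omega>
    unfolding xN yM sum_product by (simp add: ac_simps)
  show "integrable white_noise (\<lambda>\<omega>. isonormal x \<omega> * isonormal y \<omega>)"
    unfolding eq using white_noise_covariance(1) by simp
  have "(\<integral>\<omega>. isonormal x \<omega> * isonormal y \<omega> \<partial>white_noise)
      = (\<Sum>m<N. \<Sum>n<M. (coord x m * coord y n) * (if m = n then 1 else 0))"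
    unfolding eq using white_noise_covariance by simp
  also have "\<dots> = (\<Sum>m<N. coord x m * coord y m)"
  proof (rule sum.cong[OF refl])
    fix m
    show "(\<Sum>n<M. coord x m * coord y n * (if m = n then 1 else 0)) = coord x m * coord y m"
      using M[of m] by (simp add: if_distrib cong: if_cong)
  qed
  also have "\<dots> = x \<bullet> y"
    unfolding inner_finseq_def by (rule suminf_finite[symmetric]) (use N in \<open>auto simp: not_less\<close>)
  finally show "(\<integral>\<omega>. isonormal x \<omega> * isonormal y \<omega> \<partial>white_noise) = x \<bullet> y" .
qed

lemma isonormal_char: "(CLINT \<omega>|white_noise. iexp (isonormal x \<omega>)) = complex_of_real (exp (- (x \<bullet> x) / 2))"
proof -
  obtain N where N: "\<And>n. n \<ge> N \<Longrightarrow> coord x n = 0" using coord_bounded_support[of x] by blast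
  have xN: "isonormal x \<omega> = (\<Sum>n<N. coord x n * \<omega> n)" for \<omega> using N by (rule isonormal_eq_sum)
  have comp: "char (distr white_noise borel (\<lambda>\<omega>. r * \<omega> n)) 1 = complex_of_real (exp (- r\<^sup>2 / 2))" for r n
  proof -
    have "char (distr white_noise borel (\<lambda>\<omega>. r * \<omega> n)) 1 = char (distr white_noise borel (\<lambda>\<omega>. \<omega> n)) r"
      by (simp add: char_def integral_distr)
    then show ?thesis by (simp add: distr_white_noise_component char_std_normal_distribution)
  qed
  have "white_noise.indep_vars (\<lambda>_. borel) (\<lambda>n \<omega>. \<omega> n) {..<N}"
    by (rule white_noise.indep_vars_subset[OF indep_white_noise]) simp
  then have indep: "white_noise.indep_vars (\<lambda>_. borel) (\<lambda>n \<omega>. coord x n * \<omega> n) {..<N}"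
    by (rule white_noise.indep_vars_compose2[where Y = "\<lambda>n y. coord x n * y"]) simp
  have "(CLINT \<omega>|white_noise. iexp (isonormal x \<omega>)) = char (distr white_noise borel (\<lambda>\<omega>. \<Sum>n<N. coord x n * \<omega> n)) 1"
    by (simp add: char_def integral_distr xN)
  also have "\<dots> = (\<Prod>n<N. complex_of_real (exp (- (coord x n)\<^sup>2 / 2)))"
    by (simp add: white_noise.char_distr_sum[OF indep] comp)
  also have "\<dots> = complex_of_real (exp (\<Sum>n<N. - (coord x n)\<^sup>2 / 2))"
    by (simp add: exp_sum)
  also have "(\<Sum>n<N. - (coord x n)\<^sup>2 / 2) = - (\<Sum>n<N. coord x n * coord x n) / 2"
    by (simp add: power2_eq_square sum_negf flip: sum_divide_distrib)
  also have "(\<Sum>n<N. coord x n * coord x n) = x \<bullet> x"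
    unfolding inner_finseq_def by (rule suminf_finite[symmetric]) (use N in \<open>auto simp: not_less\<close>)
  finally show ?thesis .
qed

lemma integral_cos_isonormal: "(\<integral>\<omega>. cos (isonormal x \<omega>) \<partial>white_noise) = exp (- (x \<bullet> x) / 2)"
  and integral_sin_isonormal: "(\<integral>\<omega>. sin (isonormal x \<omega>) \<partial>white_noise) = 0"
proof -
  have int: "integrable white_noise (\<lambda>\<omega>. iexp (isonormal x \<omega>))"
    by (rule white_noise.integrable_const_bound[where B = 1]) auto
  show "(\<integral>\<omega>. cos (isonormal x \<omega>) \<partial>white_noise) = exp (- (x \<bullet> x) / 2)"
    using arg_cong[OF isonormal_char[of x], of Re] integral_Re[OF int] by (simp add: Re_exp)
  show "(\<integral>\<omega>. sin (isonormal x \<omega>) \<partial>white_noise) = 0"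
    using arg_cong[OF isonormal_char[of x], of Im] integral_Im[OF int] by (simp add: Im_exp)
qed

section \<open>Hilbert--Schmidt operators and Gaussian series\<close>

definition reflect :: "'b::real_inner \<Rightarrow> 'b \<Rightarrow> 'b" where
  "reflect x v = v - (2 * (v \<bullet> x) / (x \<bullet> x)) *\<^sub>R x"

lemma inner_reflect_reflect: "reflect x u \<bullet> reflect x v = u \<bullet> v"
proof (cases "x = 0")
  case False
  then have "x \<bullet> x \<noteq> 0" by simp
  moreover have "x \<bullet> v = v \<bullet> x" by (rule inner_commute)
  ultimately show ?thesis
    by (simp add: reflect_def inner_diff_left inner_diff_right field_simps)
qed (simp add: reflect_def)

lemma linear_term_zero:
  fixes a d :: real
  assumes "\<And>r. 0 \<le> r * a + r\<^sup>2 * d"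
  shows "a = 0"
proof (rule ccontr)
  assume "a \<noteq> 0"
  define D where "D = \<bar>d\<bar> + 1"
  have D: "D > 0" "d < D" by (auto simp: D_def)
  have "0 \<le> (- a / D) * a + (- a / D)\<^sup>2 * d" by (rule assms)
  also have "\<dots> = (a\<^sup>2 / D\<^sup>2) * (d - D)"
    using D by (simp add: power2_eq_square field_simps)
  also have "\<dots> < 0" using D \<open>a \<noteq> 0\<close> by (intro mult_pos_neg) auto
  finally show False by simp
qed

lemma summable_inner_mult:
  fixes v r :: "nat \<Rightarrow> 'b::real_inner"
  assumes "summable (\<lambda>k. v k \<bullet> v k)" "summable (\<lambda>k. r k \<bullet> r k)"
  shows "summable (\<lambda>k. (v k \<bullet> x) * (r k \<bullet> y))"
proof (rule summable_comparison_test')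
  show "summable (\<lambda>k. (x \<bullet> x) * (v k \<bullet> v k) + (y \<bullet> y) * (r k \<bullet> r k))"
    by (intro summable_add summable_mult assms)
  fix k
  have "\<bar>(v k \<bullet> x) * (r k \<bullet> y)\<bar> \<le> (v k \<bullet> x)\<^sup>2 + (r k \<bullet> y)\<^sup>2"
  proof -
    have "2 * (\<bar>v k \<bullet> x\<bar> * \<bar>r k \<bullet> y\<bar>) \<le> (v k \<bullet> x)\<^sup>2 + (r k \<bullet> y)\<^sup>2"
      using sum_squares_bound[of "\<bar>v k \<bullet> x\<bar>" "\<bar>r k \<bullet> y\<bar>"] by simp
    moreover have "0 \<le> \<bar>v k \<bullet> x\<bar> * \<bar>r k \<bullet> y\<bar>" by simp
    ultimately show ?thesis unfolding abs_mult by linarith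
  qed
  also have "\<dots> \<le> (x \<bullet> x) * (v k \<bullet> v k) + (y \<bullet> y) * (r k \<bullet> r k)"
    using Cauchy_Schwarz_ineq[of "v k" x] Cauchy_Schwarz_ineq[of "r k" y] by (simp add: mult.commute)
  finally show "norm ((v k \<bullet> x) * (r k \<bullet> y)) \<le> (x \<bullet> x) * (v k \<bullet> v k) + (y \<bullet> y) * (r k \<bullet> r k)" by simp
qed

text \<open>Polar-decomposition-type optimality: single reflections give positivity. Symmetry is the
  first-order condition at \<open>\<epsilon> = 0\<close> for the product of the reflections in \<open>x\<close>
  and \<open>x + \<epsilon> y\<close>.\<close>

lemma optimal_against_isometries:
  fixes v r :: "nat \<Rightarrow> 'b::real_inner"
  assumes sv: "summable (\<lambda>k. v k \<bullet> v k)" and sr: "summable (\<lambda>k. r k \<bullet> r k)"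
    and opt: "\<And>T. (\<And>x y. T x \<bullet> T y = x \<bullet> y) \<Longrightarrow> (\<Sum>k. (T (v k) - v k) \<bullet> r k) \<le> 0"
  shows "0 \<le> (\<Sum>k. (v k \<bullet> x) * (r k \<bullet> x))"
    and "(\<Sum>k. (v k \<bullet> x) * (r k \<bullet> y)) = (\<Sum>k. (v k \<bullet> y) * (r k \<bullet> x))"
proof -
  define N where "N x y = (\<Sum>k. (v k \<bullet> x) * (r k \<bullet> y))" for x y
  have N: "(\<lambda>k. (v k \<bullet> x) * (r k \<bullet> y)) sums N x y" for x y
    unfolding N_def by (rule summable_sums[OF summable_inner_mult[OF sv sr]])
  have N_zero: "N 0 y = 0" "N y 0 = 0" for y by (simp_all add: N_def)
  have N_add_left: "N (x + x') y = N x y + N x' y" for x x' y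
    using sums_add[OF N[of x y] N[of x' y]] N[of "x + x'" y]
    by (simp add: inner_add_right distrib_right sums_unique2)
  have N_add_right: "N x (y + y') = N x y + N x y'" for x y y'
    using sums_add[OF N[of x y] N[of x y']] N[of x "y + y'"]
    by (simp add: inner_add_right distrib_left sums_unique2)
  have N_scale_left: "N (c *\<^sub>R x) y = c * N x y" for c x y
    using sums_mult[OF N[of x y], of c] N[of "c *\<^sub>R x" y]
    by (simp add: mult.assoc sums_unique2)
  have N_scale_right: "N x (c *\<^sub>R y) = c * N x y" for c x y
    using sums_mult[OF N[of x y], of c] N[of x "c *\<^sub>R y"]
    by (simp add: mult.left_commute sums_unique2)
  have pos: "0 \<le> N x x" for x
  proof (cases "x = 0")
    case False
    have "(\<lambda>k. (reflect x (v k) - v k) \<bullet> r k) = (\<lambda>k. (- 2 / (x \<bullet> x)) * ((v k \<bullet> x) * (r k \<bullet> x)))"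
      by (simp add: reflect_def fun_eq_iff inner_commute)
    then have "(\<Sum>k. (reflect x (v k) - v k) \<bullet> r k) = (- 2 / (x \<bullet> x)) * N x x"
      using sums_mult[OF N[of x x], of "- 2 / (x \<bullet> x)"] by (simp only: sums_iff)
    moreover have "(\<Sum>k. (reflect x (v k) - v k) \<bullet> r k) \<le> 0"
      by (rule opt) (rule inner_reflect_reflect)
    ultimately have "0 \<le> N x x / (x \<bullet> x)" by simp
    moreover have "0 < x \<bullet> x" using False by simp
    ultimately show ?thesis by (simp add: zero_le_divide_iff)
  qed (simp add: N_zero)
  then show "0 \<le> (\<Sum>k. (v k \<bullet> x) * (r k \<bullet> x))" by (simp add: N_def)
  have two: "0 \<le> (z \<bullet> z) * N x x + (x \<bullet> x) * N z z - 2 * (x \<bullet> z) * N z x" for x z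
  proof (cases "x = 0 \<or> z = 0")
    case True
    then show ?thesis by (auto simp: N_zero)
  next
    case False
    then have q: "x \<bullet> x > 0" "z \<bullet> z > 0" by auto
    define a b c where "a = 2 / (x \<bullet> x)" and "b = 2 / (z \<bullet> z)" and "c = 4 * (x \<bullet> z) / ((x \<bullet> x) * (z \<bullet> z))"
    have "(reflect x (reflect z (v k)) - v k) \<bullet> r k
        = c * ((v k \<bullet> z) * (r k \<bullet> x)) - a * ((v k \<bullet> x) * (r k \<bullet> x)) - b * ((v k \<bullet> z) * (r k \<bullet> z))" for k
      using q by (simp add: reflect_def a_def b_def c_def inner_diff_left inner_commute[of x "r k"]
          inner_commute[of z "r k"] inner_commute[of z x] field_simps)
    moreover have "(\<lambda>k. c * ((v k \<bullet> z) * (r k \<bullet> x)) - a * ((v k \<bullet> x) * (r k \<bullet> x)) - b * ((v k \<bullet> z) * (r k \<bullet> z)))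
        sums (c * N z x - a * N x x - b * N z z)"
      by (intro sums_diff sums_mult N)
    ultimately have "(\<Sum>k. (reflect x (reflect z (v k)) - v k) \<bullet> r k) = c * N z x - a * N x x - b * N z z"
      by (simp add: sums_iff)
    moreover have "(\<Sum>k. (reflect x (reflect z (v k)) - v k) \<bullet> r k) \<le> 0"
      by (rule opt) (simp add: inner_reflect_reflect)
    ultimately have "0 \<le> ((x \<bullet> x) * (z \<bullet> z) / 2) * (a * N x x + b * N z z - c * N z x)"
      using q by simp
    also have "\<dots> = (z \<bullet> z) * N x x + (x \<bullet> x) * N z z - 2 * (x \<bullet> z) * N z x"
      using q by (simp add: a_def b_def c_def field_simps)
    finally show ?thesis .
  qed
  have "N x y = N y x"
  proof (cases "x = 0")
    case False
    have "(x \<bullet> x) * (N x y - N y x) = 0"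
    proof (rule linear_term_zero)
      fix t
      show "0 \<le> t * ((x \<bullet> x) * (N x y - N y x)) + t\<^sup>2 * ((y \<bullet> y) * N x x + (x \<bullet> x) * N y y - 2 * (x \<bullet> y) * N y x)"
        using two[of "x + t *\<^sub>R y" x]
        by (simp add: N_add_left N_add_right N_scale_left N_scale_right inner_add_left inner_add_right
            inner_commute[of y x] algebra_simps power2_eq_square)
    qed
    then show ?thesis using False by simp
  qed (simp add: N_zero)
  then show "(\<Sum>k. (v k \<bullet> x) * (r k \<bullet> y)) = (\<Sum>k. (v k \<bullet> y) * (r k \<bullet> x))" by (simp add: N_def)
qed

lemma weakly_convergent_Cauchy_tendsto:
  fixes z :: "nat \<Rightarrow> 'b::real_inner"
  assumes "Cauchy z" and weak: "\<And>x. (\<lambda>n. z n \<bullet> x) \<longlonglongrightarrow> v \<bullet> x"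
  shows "z \<longlonglongrightarrow> v"
proof (rule LIMSEQ_I)
  fix \<epsilon> :: real assume "0 < \<epsilon>"
  then obtain N where N: "\<And>m n. m \<ge> N \<Longrightarrow> n \<ge> N \<Longrightarrow> norm (z m - z n) < \<epsilon> / 2"
    using CauchyD[OF assms(1), of "\<epsilon> / 2"] by auto
  have "norm (z n - v) < \<epsilon>" if "n \<ge> N" for n
  proof -
    let ?d = "z n - v"
    have "(\<lambda>m. z n \<bullet> ?d - z m \<bullet> ?d) \<longlonglongrightarrow> z n \<bullet> ?d - v \<bullet> ?d"
      by (intro tendsto_diff tendsto_const weak)
    moreover have "z n \<bullet> ?d - z m \<bullet> ?d \<le> \<epsilon> / 2 * norm ?d" if "m \<ge> N" for m
    proof -
      have "z n \<bullet> ?d - z m \<bullet> ?d \<le> norm (z n - z m) * norm ?d"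
        using norm_cauchy_schwarz[of "z n - z m" ?d] by (simp add: inner_diff_left)
      also have "\<dots> \<le> \<epsilon> / 2 * norm ?d"
        using N[OF \<open>n \<ge> N\<close> that] by (intro mult_right_mono) auto
      finally show ?thesis .
    qed
    ultimately have "z n \<bullet> ?d - v \<bullet> ?d \<le> \<epsilon> / 2 * norm ?d"
      by (intro LIMSEQ_le_const2) blast+
    then have "norm ?d * norm ?d \<le> \<epsilon> / 2 * norm ?d"
      by (metis inner_diff_left power2_norm_eq_inner power2_eq_square)
    then have "norm ?d \<le> \<epsilon> / 2"
      using \<open>0 < \<epsilon>\<close> by (cases "norm ?d = 0") auto
    then show ?thesis using \<open>0 < \<epsilon>\<close> by simp
  qed
  then show "\<exists>no. \<forall>n\<ge>no. norm (z n - v) < \<epsilon>" by blast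
qed

context hilbert_basis
begin

definition square_summable :: "(nat \<Rightarrow> 'b::real_inner) \<Rightarrow> bool" where
  "square_summable w \<longleftrightarrow> summable (\<lambda>k. w k \<bullet> w k) \<and> (\<forall>k. e k = 0 \<longrightarrow> w k = 0)"

text \<open>The Hilbert--Schmidt operator with \<open>w k\<close> as its adjoint image of \<open>e k\<close>.\<close>

definition hs_op :: "(nat \<Rightarrow> 'b::real_inner) \<Rightarrow> 'b \<Rightarrow> 'a" where
  "hs_op w x = (\<Sum>k. (w k \<bullet> x) *\<^sub>R e k)"

lemma inner_hs_op:
  assumes "square_summable w"
  shows "e k \<bullet> hs_op w x = w k \<bullet> x"
  unfolding hs_op_def
proof (rule inner_synthesis)
  show "summable (\<lambda>k. (w k \<bullet> x)\<^sup>2)"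
    using summable_inner_mult[of w w x x] assms by (simp add: square_summable_def power2_eq_square)
qed (use assms in \<open>auto simp: square_summable_def\<close>)

lemma linear_hs_op:
  assumes "square_summable w"
  shows "linear (hs_op w)"
  by (rule linearI; rule eq_if_coordinates_eq)
     (simp_all add: inner_hs_op[OF assms] inner_add_right)

lemma inner_hs_op_hs_op:
  assumes "square_summable w" "square_summable w'"
  shows "hs_op w x \<bullet> hs_op w' y = (\<Sum>k. (w k \<bullet> x) * (w' k \<bullet> y))"
  using parseval[of "hs_op w x" "hs_op w' y"] assms by (simp add: inner_hs_op sums_iff)

lemma square_summable_add:
  assumes v: "square_summable v" and w: "square_summable w"
  shows "square_summable (\<lambda>k. v k + w k)"
  unfolding square_summable_def
proof
  show "summable (\<lambda>k. (v k + w k) \<bullet> (v k + w k))"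
  proof (rule summable_comparison_test')
    show "summable (\<lambda>k. 2 * (v k \<bullet> v k) + 2 * (w k \<bullet> w k))"
      using v w by (intro summable_add summable_mult) (auto simp: square_summable_def)
    fix k
    have "0 \<le> (v k - w k) \<bullet> (v k - w k)" by simp
    then have "(v k + w k) \<bullet> (v k + w k) \<le> 2 * (v k \<bullet> v k) + 2 * (w k \<bullet> w k)"
      by (simp add: inner_add_left inner_add_right inner_diff_left inner_diff_right)
    then show "norm ((v k + w k) \<bullet> (v k + w k)) \<le> 2 * (v k \<bullet> v k) + 2 * (w k \<bullet> w k)" by simp
  qed
qed (use v w in \<open>auto simp: square_summable_def\<close>)

lemma square_summable_sum:
  assumes "\<And>i. i \<in> I \<Longrightarrow> square_summable (w i)"
  shows "square_summable (\<lambda>k. \<Sum>i\<in>I. w i k)"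
  using assms
proof (induction I rule: infinite_finite_induct)
  case (insert i I)
  then show ?case using square_summable_add[of "w i" "\<lambda>k. \<Sum>i\<in>I. w i k"] by simp
qed (auto simp: square_summable_def)

definition gaussian_series :: "(nat \<Rightarrow> finseq) \<Rightarrow> (nat \<Rightarrow> real) \<Rightarrow> 'a" where
  "gaussian_series w \<omega> = (\<Sum>k. (if (\<Sum>k. ennreal ((isonormal (w k) \<omega>)\<^sup>2)) < \<infinity>
     then isonormal (w k) \<omega> else 0) *\<^sub>R e k)"

lemma gaussian_series_summable:
  "summable (\<lambda>k. (if (\<Sum>k. ennreal ((isonormal (w k) \<omega>)\<^sup>2)) < \<infinity> then isonormal (w k) \<omega> else 0)\<^sup>2)"
proof (cases "(\<Sum>k. ennreal ((isonormal (w k) \<omega>)\<^sup>2)) < \<infinity>")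
  case True
  then show ?thesis by (auto intro!: summable_suminf_not_top)
qed simp

lemma measurable_gaussian_series [measurable]: "gaussian_series w \<in> borel_measurable white_noise"
proof (rule borel_measurable_LIMSEQ_metric)
  show "(\<lambda>\<omega>. \<Sum>k<n. (if (\<Sum>k. ennreal ((isonormal (w k) \<omega>)\<^sup>2)) < \<infinity>
      then isonormal (w k) \<omega> else 0) *\<^sub>R e k) \<in> borel_measurable white_noise" for n
    by measurable
  show "(\<lambda>n. \<Sum>k<n. (if (\<Sum>k. ennreal ((isonormal (w k) \<omega>)\<^sup>2)) < \<infinity>
      then isonormal (w k) \<omega> else 0) *\<^sub>R e k) \<longlonglongrightarrow> gaussian_series w \<omega>" for \<omega>
    unfolding gaussian_series_def
    by (rule summable_LIMSEQ[OF summable_synthesis[OF gaussian_series_summable]])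
qed

lemma AE_inner_gaussian_series:
  assumes w: "square_summable w"
  shows "AE \<omega> in white_noise. \<forall>k. e k \<bullet> gaussian_series w \<omega> = isonormal (w k) \<omega>"
proof -
  have "(\<integral>\<^sup>+\<omega>. ennreal ((isonormal (w k) \<omega>)\<^sup>2) \<partial>white_noise) = ennreal (w k \<bullet> w k)" for k
    using isonormal_covariance[of "w k" "w k"]
    by (subst nn_integral_eq_integral) (simp_all add: power2_eq_square)
  then have "(\<integral>\<^sup>+\<omega>. (\<Sum>k. ennreal ((isonormal (w k) \<omega>)\<^sup>2)) \<partial>white_noise) = (\<Sum>k. ennreal (w k \<bullet> w k))"
    by (simp add: nn_integral_suminf)
  also have "\<dots> = ennreal (\<Sum>k. w k \<bullet> w k)"
    using w by (intro suminf_ennreal2) (auto simp: square_summable_def)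
  finally have "(\<integral>\<^sup>+\<omega>. (\<Sum>k. ennreal ((isonormal (w k) \<omega>)\<^sup>2)) \<partial>white_noise) \<noteq> \<infinity>" by simp
  then have "AE \<omega> in white_noise. (\<Sum>k. ennreal ((isonormal (w k) \<omega>)\<^sup>2)) \<noteq> \<infinity>"
    by (intro nn_integral_noteq_infinite) auto
  then show ?thesis
  proof eventually_elim
    case (elim \<omega>)
    then have fin: "(\<Sum>k. ennreal ((isonormal (w k) \<omega>)\<^sup>2)) < \<infinity>" by (simp add: less_top)
    show ?case
    proof
      fix k
      have zero: "isonormal 0 \<omega> = 0" using linear_0[OF linear_isonormal] by simp
      have "e k \<bullet> gaussian_series w \<omega> = (if (\<Sum>k. ennreal ((isonormal (w k) \<omega>)\<^sup>2)) < \<infinity> then isonormal (w k) \<omega> else 0)"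
        unfolding gaussian_series_def
        by (rule inner_synthesis[OF gaussian_series_summable])
           (use w zero in \<open>auto simp: square_summable_def\<close>)
      then show "e k \<bullet> gaussian_series w \<omega> = isonormal (w k) \<omega>" using fin by simp
    qed
  qed
qed

lemma finite_expansion:
  assumes "h \<in> span (range e)"
  obtains n where "h = (\<Sum>k<n. (e k \<bullet> h) *\<^sub>R e k)"
proof -
  have "\<exists>n. \<forall>k\<ge>n. e k \<bullet> h = 0"
    using assms
  proof (induction rule: span_induct_alt)
    case (step c x y)
    then obtain n j where n: "\<forall>k\<ge>n. e k \<bullet> y = 0" and j: "x = e j" by auto
    have "\<forall>k\<ge>max n (Suc j). e k \<bullet> (c *\<^sub>R x + y) = 0"
      using n orthogonal[of _ j] by (auto simp: inner_add_right j)
    then show ?case by blast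
  qed simp
  then obtain n where n: "\<forall>k\<ge>n. e k \<bullet> h = 0" by blast
  have "(\<lambda>k. (e k \<bullet> h) *\<^sub>R e k) sums (\<Sum>k<n. (e k \<bullet> h) *\<^sub>R e k)"
    by (rule sums_finite) (use n in \<open>auto simp: not_less\<close>)
  then show ?thesis using that expansion[of h] sums_unique2 by blast
qed

lemma gaussian_series_law:
  assumes w: "square_summable w" and "inner_gaussian \<mu>"
    and cov: "\<And>k m. w k \<bullet> w m = (\<integral>x. (e k \<bullet> x) * (e m \<bullet> x) \<partial>\<mu>)"
  shows "distr white_noise borel (gaussian_series w) = \<mu>"
proof (rule measure_eq_if_char_eq)
  interpret inner_gaussian \<mu> by fact
  show "prob_space (distr white_noise borel (gaussian_series w))"
    by (rule white_noise.prob_space_distr) simp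
  show "prob_space \<mu>" by unfold_locales
  show "sets \<mu> = sets borel" by simp
  fix h assume "h \<in> span (range e)"
  then obtain n where h: "h = (\<Sum>k<n. (e k \<bullet> h) *\<^sub>R e k)" by (rule finite_expansion)
  define u where "u k = e k \<bullet> h" for k
  have h_inner: "h \<bullet> x = (\<Sum>k<n. u k * (e k \<bullet> x))" for x
    by (subst h) (simp add: inner_sum_left u_def)
  define y where "y = (\<Sum>k<n. u k *\<^sub>R w k)"
  have "AE \<omega> in white_noise. h \<bullet> gaussian_series w \<omega> = isonormal y \<omega>"
    using AE_inner_gaussian_series[OF w]
  proof eventually_elim
    case (elim \<omega>)
    then show ?case
      by (simp add: h_inner y_def linear_sum[OF linear_isonormal] linear_scale[OF linear_isonormal])
  qed
  note AE = this
  have "var h = (\<integral>x. (\<Sum>k<n. \<Sum>m<n. (u k * u m) * ((e k \<bullet> x) * (e m \<bullet> x))) \<partial>\<mu>)"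
    unfolding var_def h_inner power2_eq_square sum_product by (simp add: ac_simps)
  also have "\<dots> = (\<Sum>k<n. \<Sum>m<n. (u k * u m) * (w k \<bullet> w m))"
    using integrable_inner_mult by (simp add: cov)
  also have "\<dots> = y \<bullet> y"
    unfolding y_def by (subst inner_sum_left) (simp add: inner_sum_right sum_distrib_left ac_simps)
  finally have var: "var h = y \<bullet> y" .
  have "(\<integral>x. cos (h \<bullet> x) \<partial>distr white_noise borel (gaussian_series w)) = (\<integral>\<omega>. cos (isonormal y \<omega>) \<partial>white_noise)"
    using AE by (simp add: integral_distr) (intro integral_cong_AE, auto)
  then show "(\<integral>x. cos (h \<bullet> x) \<partial>distr white_noise borel (gaussian_series w)) = (\<integral>x. cos (h \<bullet> x) \<partial>\<mu>)"
    by (simp add: integral_cos_isonormal integral_cos_inner var)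
  have "(\<integral>x. sin (h \<bullet> x) \<partial>distr white_noise borel (gaussian_series w)) = (\<integral>\<omega>. sin (isonormal y \<omega>) \<partial>white_noise)"
    using AE by (simp add: integral_distr) (intro integral_cong_AE, auto)
  then show "(\<integral>x. sin (h \<bullet> x) \<partial>distr white_noise borel (gaussian_series w)) = (\<integral>x. sin (h \<bullet> x) \<partial>\<mu>)"
    by (simp add: integral_sin_isonormal integral_sin_inner)
qed simp

lemma gaussian_series_operator:
  assumes a: "square_summable a" and b: "square_summable b"
    and sym: "\<And>u v. t u \<bullet> v = u \<bullet> t v"
    and tb: "\<And>x. t (hs_op b x) = hs_op a x"
  shows "AE \<omega> in white_noise. t (gaussian_series b \<omega>) = gaussian_series a \<omega>"
proof -
  have coord: "AE \<omega> in white_noise. e k \<bullet> t (gaussian_series b \<omega>) = isonormal (a k) \<omega>" for k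
  proof -
    define h where "h = t (e k)"
    define z where "z n = (\<Sum>m<n. (e m \<bullet> h) *\<^sub>R b m)" for n
    have "summable (\<lambda>m. (e m \<bullet> h)\<^sup>2 + b m \<bullet> b m)"
      using parseval[of h h] b
      by (intro summable_add) (auto simp: square_summable_def sums_iff power2_eq_square)
    then have sum_norm: "summable (\<lambda>m. norm ((e m \<bullet> h) *\<^sub>R b m))"
    proof (rule summable_comparison_test'[where N = 0])
      fix m
      have "2 * (\<bar>e m \<bullet> h\<bar> * norm (b m)) \<le> (e m \<bullet> h)\<^sup>2 + (norm (b m))\<^sup>2"
        using sum_squares_bound[of "\<bar>e m \<bullet> h\<bar>" "norm (b m)"] by simp
      moreover have "0 \<le> \<bar>e m \<bullet> h\<bar> * norm (b m)" by simp
      ultimately have "\<bar>e m \<bullet> h\<bar> * norm (b m) \<le> (e m \<bullet> h)\<^sup>2 + (norm (b m))\<^sup>2" by linarith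
      then show "norm (norm ((e m \<bullet> h) *\<^sub>R b m)) \<le> (e m \<bullet> h)\<^sup>2 + b m \<bullet> b m"
        by (simp add: power2_norm_eq_inner)
    qed
    have "Cauchy z"
    proof (rule CauchyI')
      fix r :: real assume "0 < r"
      then obtain N where N: "\<And>m n. m \<ge> N \<Longrightarrow> norm (\<Sum>j=m..<n. norm ((e j \<bullet> h) *\<^sub>R b j)) < r"
        using sum_norm unfolding summable_Cauchy by metis
      have "norm (z m - z n) < r" if "m \<ge> N" "n > m" for m n
      proof -
        have "z n - z m = (\<Sum>j=m..<n. (e j \<bullet> h) *\<^sub>R b j)"
          using sum_diff_nat_ivl[of 0 m n "\<lambda>j. (e j \<bullet> h) *\<^sub>R b j"] that
          by (simp add: z_def atLeast0LessThan)
        then have "norm (z n - z m) \<le> (\<Sum>j=m..<n. norm ((e j \<bullet> h) *\<^sub>R b j))"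
          by (simp add: sum_norm_le)
        also have "\<dots> < r" using N[OF that(1), of n] by simp
        finally show ?thesis by (simp add: norm_minus_commute)
      qed
      then show "\<exists>M. \<forall>m\<ge>M. \<forall>n>m. dist (z m) (z n) < r"
        unfolding dist_norm by blast
    qed
    moreover have "(\<lambda>n. z n \<bullet> x) \<longlonglongrightarrow> a k \<bullet> x" for x
    proof -
      have "(\<lambda>m. (e m \<bullet> h) * (b m \<bullet> x)) sums (h \<bullet> hs_op b x)"
        using parseval[of h "hs_op b x"] by (simp add: inner_hs_op[OF b])
      moreover have "h \<bullet> hs_op b x = a k \<bullet> x"
        by (simp add: h_def sym tb inner_hs_op[OF a])
      ultimately show ?thesis by (simp add: sums_def z_def inner_sum_left)
    qed
    ultimately have lim: "z \<longlonglongrightarrow> a k" by (rule weakly_convergent_Cauchy_tendsto)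
    have AE: "AE \<omega> in white_noise. (\<lambda>n. isonormal (z n) \<omega>) \<longlonglongrightarrow> e k \<bullet> t (gaussian_series b \<omega>)"
      using AE_inner_gaussian_series[OF b]
    proof eventually_elim
      case (elim \<omega>)
      have "(\<lambda>m. (e m \<bullet> h) * isonormal (b m) \<omega>) sums (h \<bullet> gaussian_series b \<omega>)"
        using parseval[of h "gaussian_series b \<omega>"] elim by simp
      then show ?case
        by (simp add: sums_def z_def linear_sum[OF linear_isonormal] linear_scale[OF linear_isonormal] h_def sym)
    qed
    have L2: "(\<integral>\<^sup>+\<omega>. ennreal ((isonormal (z n) \<omega> - isonormal (a k) \<omega>)\<^sup>2) \<partial>white_noise) = ennreal ((norm (z n - a k))\<^sup>2)" for n
    proof -
      have "isonormal (z n) \<omega> - isonormal (a k) \<omega> = isonormal (z n - a k) \<omega>" for \<omega>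
        by (simp add: linear_diff[OF linear_isonormal])
      then show ?thesis
        using isonormal_covariance[of "z n - a k" "z n - a k"]
        by (subst nn_integral_eq_integral) (simp_all add: power2_eq_square power2_norm_eq_inner[unfolded power2_eq_square])
    qed
    let ?g = "\<lambda>\<omega>. liminf (\<lambda>n. ennreal ((isonormal (z n) \<omega> - isonormal (a k) \<omega>)\<^sup>2))"
    have "(\<integral>\<^sup>+\<omega>. ?g \<omega> \<partial>white_noise) \<le> liminf (\<lambda>n. ennreal ((norm (z n - a k))\<^sup>2))"
      using nn_integral_liminf[of "\<lambda>n \<omega>. ennreal ((isonormal (z n) \<omega> - isonormal (a k) \<omega>)\<^sup>2)" white_noise]
      by (simp add: L2)
    also have "\<dots> = 0"
    proof -
      have "(\<lambda>n. (norm (z n - a k))\<^sup>2) \<longlonglongrightarrow> (norm (a k - a k))\<^sup>2"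
        by (intro tendsto_intros lim)
      then have "(\<lambda>n. ennreal ((norm (z n - a k))\<^sup>2)) \<longlonglongrightarrow> ennreal 0"
        by (intro tendsto_ennrealI) simp
      then show ?thesis using lim_imp_Liminf[of sequentially] by fastforce
    qed
    finally have "AE \<omega> in white_noise. ?g \<omega> = 0"
      by (subst nn_integral_0_iff_AE[symmetric]) auto
    with AE show ?thesis
    proof eventually_elim
      case (elim \<omega>)
      have "(\<lambda>n. ennreal ((isonormal (z n) \<omega> - isonormal (a k) \<omega>)\<^sup>2))
          \<longlonglongrightarrow> ennreal ((e k \<bullet> t (gaussian_series b \<omega>) - isonormal (a k) \<omega>)\<^sup>2)"
        by (intro tendsto_ennrealI tendsto_intros elim(1))
      then have "?g \<omega> = ennreal ((e k \<bullet> t (gaussian_series b \<omega>) - isonormal (a k) \<omega>)\<^sup>2)"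
        by (intro lim_imp_Liminf) auto
      then show ?case using elim(2) by (simp add: ennreal_eq_0_iff)
    qed
  qed
  then have "AE \<omega> in white_noise. \<forall>k. e k \<bullet> t (gaussian_series b \<omega>) = isonormal (a k) \<omega>"
    by (simp add: AE_all_countable)
  with AE_inner_gaussian_series[OF a] show ?thesis
    by eventually_elim (rule eq_if_coordinates_eq, simp)
qed

end

section \<open>Covariances of multicouplings\<close>

locale gaussian_family = hilbert_basis e
  for e :: "nat \<Rightarrow> 'a::{real_inner, polish_space}" +
  fixes K :: nat and \<gamma> :: "nat \<Rightarrow> 'a measure"
  assumes gaussian: "j < K \<Longrightarrow> inner_gaussian (\<gamma> j)"
begin

definition block :: "nat \<Rightarrow> nat \<Rightarrow> nat \<Rightarrow> real" where
  "block i k m = (if i < K then \<integral>x. (e k \<bullet> x) * (e m \<bullet> x) \<partial>\<gamma> i else 0)"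

text \<open>Covariance kernels of multicouplings: the index \<open>(i, k)\<close> stands for the \<open>k\<close>-th
  coordinate of the \<open>i\<close>-th component.\<close>

definition feasible :: "(nat \<times> nat \<Rightarrow> nat \<times> nat \<Rightarrow> real) \<Rightarrow> bool" where
  "feasible c \<longleftrightarrow> psd_kernel c \<and> (\<forall>i k m. c (i, k) (i, m) = block i k m)"

definition total_trace :: "(nat \<times> nat \<Rightarrow> nat \<times> nat \<Rightarrow> real) \<Rightarrow> real" where
  "total_trace c = (\<Sum>k. \<Sum>i<K. \<Sum>j<K. c (i, k) (j, k))"

lemma block_eq_var: "j < K \<Longrightarrow> block j k k = inner_gaussian.var (\<gamma> j) (e k)"
  using inner_gaussian.var_def[OF gaussian] by (simp add: block_def power2_eq_square)

lemma summable_block: "summable (\<lambda>k. block i k k)"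
proof (cases "i < K")
  case True
  then show ?thesis
    using inner_gaussian.summable_var_basis[OF gaussian hilbert_basis_axioms] by (simp add: block_eq_var)
qed (simp add: block_def)

lemma feasible_entry_bound: "feasible c \<Longrightarrow> \<bar>c (i, k) (j, m)\<bar> \<le> (block i k k + block j m m) / 2"
  using psd_kernel_abs_le[of c "(i, k)" "(j, m)"] by (simp add: feasible_def)

lemma feasible_trace_bound:
  assumes "feasible c"
  shows "\<bar>\<Sum>i<K. \<Sum>j<K. c (i, k) (j, k)\<bar> \<le> (\<Sum>i<K. \<Sum>j<K. (block i k k + block j k k) / 2)"
  by (intro order_trans[OF sum_abs] sum_mono) (rule feasible_entry_bound[OF assms])

lemma summable_trace_bound: "summable (\<lambda>k. \<Sum>i<K. \<Sum>j<K. (block i k k + block j k k) / 2)"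
  by (intro summable_sum summable_divide summable_add summable_block)

lemma summable_entry:
  assumes "feasible c"
  shows "summable (\<lambda>k. c (i, k) (j, k))"
  by (rule summable_comparison_test'[where g = "\<lambda>k. (block i k k + block j k k) / 2"])
     (use feasible_entry_bound[OF assms] in \<open>auto intro!: summable_divide summable_add summable_block\<close>)

lemma total_trace_maximizer:
  assumes "feasible c\<^sub>0"
  obtains c where "feasible c" "\<And>c'. feasible c' \<Longrightarrow> total_trace c' \<le> total_trace c"
proof -
  define S where "S = {u :: (nat \<times> nat) \<times> (nat \<times> nat) \<Rightarrow> real. feasible (curry u)}"
  define B where "B = (\<lambda>((i, k), (j, m)). {- ((block i k k + block j m m) / 2) .. (block i k k + block j m m) / 2})"
  have cont: "continuous_on UNIV (\<lambda>u :: (nat \<times> nat) \<times> (nat \<times> nat) \<Rightarrow> real. u p)" for p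
    by (rule continuous_on_product_coordinates)
  have "S = (\<Inter>m n. {u. u (m, n) = u (n, m)})
      \<inter> (\<Inter>F\<in>{F. finite F}. \<Inter>x. {u. 0 \<le> (\<Sum>m\<in>F. \<Sum>n\<in>F. x m * x n * u (m, n))})
      \<inter> (\<Inter>i k m. {u. u ((i, k), (i, m)) = block i k m})"
    unfolding S_def feasible_def psd_kernel_def curry_def by auto
  moreover have "closed \<dots>"
    by (intro closed_Int closed_INT ballI closed_Collect_eq closed_Collect_le continuous_intros cont)
  ultimately have "closed S" by simp
  moreover have "compact (PiE UNIV B)"
  proof -
    have "compactin (product_topology (\<lambda>_. euclidean) UNIV) (PiE UNIV B)"
      unfolding compactin_PiE by (auto simp: B_def)
    then show ?thesis by (simp add: euclidean_product_topology)
  qed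
  moreover have "S \<subseteq> PiE UNIV B"
  proof
    fix u assume "u \<in> S"
    then have f: "feasible (curry u)" by (simp add: S_def)
    have "u p \<in> B p" for p
    proof -
      obtain i k j m where p: "p = ((i, k), (j, m))" by (metis surj_pair)
      have "\<bar>u p\<bar> \<le> (block i k k + block j m m) / 2"
        using feasible_entry_bound[OF f, of i k j m] by (simp only: p curry_conv)
      then have "- ((block i k k + block j m m) / 2) \<le> u p" "u p \<le> (block i k k + block j m m) / 2"
        by linarith+
      then show ?thesis by (simp only: p B_def prod.case atLeastAtMost_iff)
    qed
    then show "u \<in> PiE UNIV B" by (simp add: PiE_UNIV_domain)
  qed
  ultimately have "compact S" by (metis compact_Int_closed inf.absorb2)
  moreover have "S \<noteq> {}"
  proof -
    have "curry (\<lambda>(p, q). c\<^sub>0 p q) = c\<^sub>0" by (simp add: curry_def)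
    then have "(\<lambda>(p, q). c\<^sub>0 p q) \<in> S" using assms by (simp add: S_def)
    then show ?thesis by blast
  qed
  moreover have "continuous_on S (\<lambda>u. total_trace (curry u))"
  proof (rule uniform_limit_theorem)
    show "uniform_limit S (\<lambda>n u. \<Sum>k<n. \<Sum>i<K. \<Sum>j<K. curry u (i, k) (j, k))
        (\<lambda>u. total_trace (curry u)) sequentially"
      unfolding total_trace_def
      by (rule Weierstrass_m_test[OF _ summable_trace_bound])
         (simp only: S_def mem_Collect_eq real_norm_def, rule feasible_trace_bound)
    show "\<forall>\<^sub>F n in sequentially. continuous_on S (\<lambda>u. \<Sum>k<n. \<Sum>i<K. \<Sum>j<K. curry u (i, k) (j, k))"
      by (intro always_eventually allI continuous_on_sum)
         (auto simp: curry_def intro: continuous_on_subset[OF cont])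
  qed simp
  ultimately obtain u where u: "u \<in> S" "\<And>u'. u' \<in> S \<Longrightarrow> total_trace (curry u') \<le> total_trace (curry u)"
    using continuous_attains_sup[of S] by blast
  show ?thesis
  proof (rule that[of "curry u"])
    show "feasible (curry u)" using u(1) by (simp add: S_def)
    fix c' assume "feasible c'"
    moreover have "curry (\<lambda>(p, q). c' p q) = c'" by (simp add: curry_def)
    ultimately show "total_trace c' \<le> total_trace (curry u)"
      using u(2)[of "\<lambda>(p, q). c' p q"] by (simp add: S_def)
  qed
qed

definition cov :: "(nat \<Rightarrow> 'a) measure \<Rightarrow> nat \<times> nat \<Rightarrow> nat \<times> nat \<Rightarrow> real" where
  "cov \<pi> p q = (if fst p < K \<and> fst q < K
     then \<integral>x. (e (snd p) \<bullet> x (fst p)) * (e (snd q) \<bullet> x (fst q)) \<partial>\<pi> else 0)"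

context
  fixes \<pi> assumes \<pi>: "multicoupling K \<gamma> \<pi>"
begin

lemma measurable_coupling_component: "i < K \<Longrightarrow> (\<lambda>x. x i) \<in> borel_measurable \<pi>"
proof -
  assume "i < K"
  have "sets \<pi> = sets (PiM {..<K} (\<lambda>_. borel))"
    using \<pi> by (simp add: multicoupling_def prodK_def)
  then show ?thesis
    using \<open>i < K\<close> measurable_component_singleton[of i "{..<K}" "\<lambda>_. borel"]
    by (simp add: measurable_cong_sets[of \<pi> "PiM {..<K} (\<lambda>_. borel)"])
qed

lemma coupling_marginal:
  assumes "i < K" and f: "f \<in> borel_measurable borel"
  shows "integrable \<pi> (\<lambda>x. f (x i) :: real) \<longleftrightarrow> integrable (\<gamma> i) f"
    and "(\<integral>x. f (x i) \<partial>\<pi>) = (\<integral>x. f x \<partial>\<gamma> i)"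
proof -
  have "\<gamma> i = distr \<pi> borel (\<lambda>x. x i)" using \<pi> assms(1) by (simp add: multicoupling_def)
  then show "integrable \<pi> (\<lambda>x. f (x i)) \<longleftrightarrow> integrable (\<gamma> i) f" "(\<integral>x. f (x i) \<partial>\<pi>) = (\<integral>x. f x \<partial>\<gamma> i)"
    using measurable_coupling_component[OF assms(1)] f
    by (simp_all add: integrable_distr_eq integral_distr)
qed

lemma integrable_coupling_mult:
  assumes "i < K" "j < K"
  shows "integrable \<pi> (\<lambda>x. (g \<bullet> x i) * (h \<bullet> x j))"
proof (rule integrable_mult_squares)
  show "integrable \<pi> (\<lambda>x. (g \<bullet> x i)\<^sup>2)"
    using coupling_marginal(1)[OF assms(1), of "\<lambda>y. (g \<bullet> y)\<^sup>2"]
      inner_gaussian.integrable_inner_power2[OF gaussian[OF assms(1)]] by simp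
  show "integrable \<pi> (\<lambda>x. (h \<bullet> x j)\<^sup>2)"
    using coupling_marginal(1)[OF assms(2), of "\<lambda>y. (h \<bullet> y)\<^sup>2"]
      inner_gaussian.integrable_inner_power2[OF gaussian[OF assms(2)]] by simp
qed (use measurable_coupling_component assms in \<open>auto intro!: borel_measurable_inner\<close>)

lemma feasible_cov: "feasible (cov \<pi>)"
  unfolding feasible_def psd_kernel_def
proof (intro conjI allI impI)
  show "cov \<pi> m n = cov \<pi> n m" for m n by (simp add: cov_def mult.commute)
  show "cov \<pi> (i, k) (i, m) = block i k m" for i k m
    using coupling_marginal(2)[of i "\<lambda>y. (e k \<bullet> y) * (e m \<bullet> y)"] by (auto simp: cov_def block_def)
next
  fix F :: "(nat \<times> nat) set" and y :: "nat \<times> nat \<Rightarrow> real"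
  assume "finite F"
  define G where "G = {p \<in> F. fst p < K}"
  have "finite G" using \<open>finite F\<close> by (simp add: G_def)
  have int: "integrable \<pi> (\<lambda>x. (y p * (e (snd p) \<bullet> x (fst p))) * (y q * (e (snd q) \<bullet> x (fst q))))"
    if "p \<in> G" "q \<in> G" for p q
  proof -
    have "integrable \<pi> (\<lambda>x. (y p * y q) * ((e (snd p) \<bullet> x (fst p)) * (e (snd q) \<bullet> x (fst q))))"
      using that by (intro integrable_mult_right integrable_coupling_mult) (auto simp: G_def)
    then show ?thesis by (simp add: ac_simps)
  qed
  have "0 \<le> (\<integral>x. (\<Sum>p\<in>G. y p * (e (snd p) \<bullet> x (fst p)))\<^sup>2 \<partial>\<pi>)" by simp
  also have "\<dots> = (\<integral>x. (\<Sum>p\<in>G. \<Sum>q\<in>G. (y p * (e (snd p) \<bullet> x (fst p))) * (y q * (e (snd q) \<bullet> x (fst q)))) \<partial>\<pi>)"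
    by (simp only: power2_eq_square sum_product)
  also have "\<dots> = (\<Sum>p\<in>G. \<Sum>q\<in>G. \<integral>x. (y p * (e (snd p) \<bullet> x (fst p))) * (y q * (e (snd q) \<bullet> x (fst q))) \<partial>\<pi>)"
    using int by (simp add: Bochner_Integration.integral_sum Bochner_Integration.integrable_sum)
  also have "\<dots> = (\<Sum>p\<in>G. \<Sum>q\<in>G. y p * y q * cov \<pi> p q)"
  proof (intro sum.cong refl)
    fix p q assume "p \<in> G" "q \<in> G"
    then have "(\<integral>x. (y p * y q) * ((e (snd p) \<bullet> x (fst p)) * (e (snd q) \<bullet> x (fst q))) \<partial>\<pi>) = y p * y q * cov \<pi> p q"
      by (simp add: cov_def G_def)
    then show "(\<integral>x. (y p * (e (snd p) \<bullet> x (fst p))) * (y q * (e (snd q) \<bullet> x (fst q))) \<partial>\<pi>) = y p * y q * cov \<pi> p q"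
      by (simp only: ac_simps)
  qed
  also have "\<dots> = (\<Sum>p\<in>G. \<Sum>q\<in>F. y p * y q * cov \<pi> p q)"
    by (intro sum.cong refl sum.mono_neutral_left \<open>finite F\<close>) (auto simp: G_def cov_def)
  also have "\<dots> = (\<Sum>p\<in>F. \<Sum>q\<in>F. y p * y q * cov \<pi> p q)"
    by (intro sum.mono_neutral_left \<open>finite F\<close>) (auto simp: G_def cov_def intro!: sum.neutral)
  finally show "0 \<le> (\<Sum>p\<in>F. \<Sum>q\<in>F. y p * y q * cov \<pi> p q)" .
qed

lemma nn_integral_dist_square:
  assumes "i < K" "j < K"
  shows "(\<integral>\<^sup>+x. ennreal ((norm (x i - x j))\<^sup>2) \<partial>\<pi>)
    = ennreal (\<Sum>k. block i k k + block j k k - 2 * cov \<pi> (i, k) (j, k))"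
    and "0 \<le> (\<Sum>k. block i k k + block j k k - 2 * cov \<pi> (i, k) (j, k))"
proof -
  note [measurable] = measurable_coupling_component[OF assms(1)] measurable_coupling_component[OF assms(2)]
  have term_eq: "(\<integral>\<^sup>+x. ennreal ((e k \<bullet> (x i - x j))\<^sup>2) \<partial>\<pi>)
      = ennreal (block i k k + block j k k - 2 * cov \<pi> (i, k) (j, k))"
    and nonneg: "0 \<le> block i k k + block j k k - 2 * cov \<pi> (i, k) (j, k)" for k
  proof -
    have eq: "(e k \<bullet> (x i - x j))\<^sup>2 = (e k \<bullet> x i) * (e k \<bullet> x i) + (e k \<bullet> x j) * (e k \<bullet> x j)
        - 2 * ((e k \<bullet> x i) * (e k \<bullet> x j))" for x :: "nat \<Rightarrow> 'a"
      by (simp add: inner_diff_right power2_eq_square algebra_simps)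
    have ints: "integrable \<pi> (\<lambda>x. (e k \<bullet> x i) * (e k \<bullet> x i))" "integrable \<pi> (\<lambda>x. (e k \<bullet> x j) * (e k \<bullet> x j))"
      "integrable \<pi> (\<lambda>x. (e k \<bullet> x i) * (e k \<bullet> x j))"
      using assms by (auto intro: integrable_coupling_mult)
    have int: "integrable \<pi> (\<lambda>x. (e k \<bullet> (x i - x j))\<^sup>2)" unfolding eq using ints by simp
    have val: "(\<integral>x. (e k \<bullet> (x i - x j))\<^sup>2 \<partial>\<pi>) = block i k k + block j k k - 2 * cov \<pi> (i, k) (j, k)"
      unfolding eq using ints coupling_marginal(2)[OF assms(1), of "\<lambda>y. (e k \<bullet> y) * (e k \<bullet> y)"]
        coupling_marginal(2)[OF assms(2), of "\<lambda>y. (e k \<bullet> y) * (e k \<bullet> y)"] assms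
      by (simp add: block_def cov_def)
    show "(\<integral>\<^sup>+x. ennreal ((e k \<bullet> (x i - x j))\<^sup>2) \<partial>\<pi>)
        = ennreal (block i k k + block j k k - 2 * cov \<pi> (i, k) (j, k))"
      by (simp add: nn_integral_eq_integral[OF int] val)
    show "0 \<le> block i k k + block j k k - 2 * cov \<pi> (i, k) (j, k)" unfolding val[symmetric] by simp
  qed
  have "ennreal ((norm z)\<^sup>2) = (\<Sum>k. ennreal ((e k \<bullet> z)\<^sup>2))" for z
    using parseval[of z z]
    by (subst suminf_ennreal2) (auto simp: sums_iff power2_norm_eq_inner power2_eq_square[of "_ \<bullet> _"])
  then have "(\<integral>\<^sup>+x. ennreal ((norm (x i - x j))\<^sup>2) \<partial>\<pi>) = (\<Sum>k. \<integral>\<^sup>+x. ennreal ((e k \<bullet> (x i - x j))\<^sup>2) \<partial>\<pi>)"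
    by (simp add: nn_integral_suminf)
  also have "\<dots> = ennreal (\<Sum>k. block i k k + block j k k - 2 * cov \<pi> (i, k) (j, k))"
    unfolding term_eq
    by (intro suminf_ennreal2 nonneg summable_diff summable_add summable_block summable_mult
        summable_entry feasible_cov)
  finally show "(\<integral>\<^sup>+x. ennreal ((norm (x i - x j))\<^sup>2) \<partial>\<pi>)
    = ennreal (\<Sum>k. block i k k + block j k k - 2 * cov \<pi> (i, k) (j, k))" .
  show "0 \<le> (\<Sum>k. block i k k + block j k k - 2 * cov \<pi> (i, k) (j, k))"
    by (intro suminf_nonneg nonneg summable_diff summable_add summable_block summable_mult
        summable_entry feasible_cov)
qed

lemma mc_cost_eq:
  "mc_cost K \<pi> = ennreal (1 / (2 * (real K)\<^sup>2) *
     ((\<Sum>i<K. \<Sum>j<K. \<Sum>k. block i k k + block j k k) - 2 * total_trace (cov \<pi>)))"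
proof -
  have "(\<Sum>i<K. \<Sum>j<K. \<integral>\<^sup>+x. ennreal ((norm (x i - x j))\<^sup>2) \<partial>\<pi>)
      = ennreal (\<Sum>i<K. \<Sum>j<K. \<Sum>k. block i k k + block j k k - 2 * cov \<pi> (i, k) (j, k))"
  proof -
    let ?a = "\<lambda>i j. \<Sum>k. block i k k + block j k k - 2 * cov \<pi> (i, k) (j, k)"
    have "(\<Sum>i<K. \<Sum>j<K. \<integral>\<^sup>+x. ennreal ((norm (x i - x j))\<^sup>2) \<partial>\<pi>) = (\<Sum>i<K. \<Sum>j<K. ennreal (?a i j))"
      by (intro sum.cong refl nn_integral_dist_square(1)) auto
    also have "\<dots> = (\<Sum>i<K. ennreal (\<Sum>j<K. ?a i j))"
      by (intro sum.cong refl sum_ennreal nn_integral_dist_square(2)) auto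
    also have "\<dots> = ennreal (\<Sum>i<K. \<Sum>j<K. ?a i j)"
      by (intro sum_ennreal sum_nonneg nn_integral_dist_square(2)) auto
    finally show ?thesis .
  qed
  also have "(\<Sum>i<K. \<Sum>j<K. \<Sum>k. block i k k + block j k k - 2 * cov \<pi> (i, k) (j, k))
      = (\<Sum>i<K. \<Sum>j<K. (\<Sum>k. block i k k + block j k k) - 2 * (\<Sum>k. cov \<pi> (i, k) (j, k)))"
    by (simp add: suminf_diff[symmetric] suminf_mult summable_add summable_block summable_mult
        summable_entry[OF feasible_cov])
  also have "\<dots> = (\<Sum>i<K. \<Sum>j<K. \<Sum>k. block i k k + block j k k) - 2 * total_trace (cov \<pi>)"
  proof -
    have "total_trace (cov \<pi>) = (\<Sum>i<K. \<Sum>j<K. \<Sum>k. cov \<pi> (i, k) (j, k))"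
      unfolding total_trace_def
      by (simp add: suminf_sum summable_sum summable_entry[OF feasible_cov])
    then show ?thesis by (simp add: sum_subtractf sum_distrib_left)
  qed
  finally show ?thesis by (simp add: mc_cost_def ennreal_mult'[symmetric])
qed

end

end

context gaussian_family
begin

lemma prob_space_marginal: "j < K \<Longrightarrow> prob_space (\<gamma> j)"
  and sets_marginal: "j < K \<Longrightarrow> sets (\<gamma> j) = sets borel"
  using gaussian by (auto simp: inner_gaussian_def centred_gaussian_def)

lemma multicoupling_product: "multicoupling K \<gamma> (PiM {..<K} \<gamma>)"
  unfolding multicoupling_def prodK_def
proof (intro conjI allI impI)
  show "prob_space (PiM {..<K} \<gamma>)" by (rule prob_space_PiM) (simp add: prob_space_marginal)
  show "sets (PiM {..<K} \<gamma>) = sets (PiM {..<K} (\<lambda>_. borel))"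
    by (rule sets_PiM_cong) (simp_all add: sets_marginal)
  fix j assume j: "j < K"
  have "distr (PiM {..<K} \<gamma>) borel (\<lambda>x. x j) = distr (PiM {..<K} \<gamma>) (\<gamma> j) (\<lambda>x. x j)"
    by (rule distr_cong) (simp_all add: sets_marginal j)
  also have "\<dots> = \<gamma> j"
    by (rule distr_PiM_component) (simp_all add: prob_space_marginal j)
  finally show "distr (PiM {..<K} \<gamma>) borel (\<lambda>x. x j) = \<gamma> j" .
qed

context
  fixes v :: "nat \<times> nat \<Rightarrow> finseq"
  assumes feasible_v: "feasible (\<lambda>p q. v p \<bullet> v q)"
begin

lemma square_summable_gram: "square_summable (\<lambda>k. v (i, k))"
proof -
  have vv: "v (i, k) \<bullet> v (i, m) = block i k m" for k m using feasible_v by (simp add: feasible_def)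
  have "v (i, k) = 0" if "e k = 0" for k
    using vv[of k k] that by (simp add: block_def split: if_splits)
  then show ?thesis using summable_block[of i] by (simp add: square_summable_def vv)
qed

definition series_law :: "(nat \<Rightarrow> 'a) measure" where
  "series_law = distr white_noise (prodK K) (\<lambda>\<omega>. \<lambda>i\<in>{..<K}. gaussian_series (\<lambda>k. v (i, k)) \<omega>)"

lemma measurable_series: "(\<lambda>\<omega>. \<lambda>i\<in>{..<K}. gaussian_series (\<lambda>k. v (i, k)) \<omega>) \<in> measurable white_noise (prodK K)"
  unfolding prodK_def by (rule measurable_restrict) simp

lemma measurable_prodK_component: "i < K \<Longrightarrow> (\<lambda>x. x i) \<in> measurable (prodK K) borel"
  unfolding prodK_def by (rule measurable_component_singleton) simp

lemma multicoupling_series_law: "multicoupling K \<gamma> series_law"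
  unfolding multicoupling_def
proof (intro conjI allI impI)
  show "prob_space series_law"
    unfolding series_law_def by (rule white_noise.prob_space_distr[OF measurable_series])
  show "sets series_law = sets (prodK K)" by (simp add: series_law_def)
  fix j assume j: "j < K"
  have "distr series_law borel (\<lambda>x. x j) = distr white_noise borel (gaussian_series (\<lambda>k. v (j, k)))"
    unfolding series_law_def
    using j by (simp add: distr_distr[OF measurable_prodK_component[OF j] measurable_series] comp_def)
  also have "\<dots> = \<gamma> j"
    using feasible_v j
    by (intro gaussian_series_law square_summable_gram gaussian) (simp_all add: feasible_def block_def)
  finally show "distr series_law borel (\<lambda>x. x j) = \<gamma> j" .
qed

lemma cov_series_law:
  assumes "i < K" "j < K"
  shows "cov series_law (i, k) (j, m) = v (i, k) \<bullet> v (j, m)"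
proof -
  note [measurable] = measurable_prodK_component[OF assms(1)] measurable_prodK_component[OF assms(2)]
  have "cov series_law (i, k) (j, m)
      = (\<integral>\<omega>. (e k \<bullet> gaussian_series (\<lambda>k. v (i, k)) \<omega>) * (e m \<bullet> gaussian_series (\<lambda>k. v (j, k)) \<omega>) \<partial>white_noise)"
    using assms unfolding cov_def series_law_def
    by (subst integral_distr[OF measurable_series]) simp_all
  also have "\<dots> = (\<integral>\<omega>. isonormal (v (i, k)) \<omega> * isonormal (v (j, m)) \<omega> \<partial>white_noise)"
    using AE_inner_gaussian_series[OF square_summable_gram[of i]]
      AE_inner_gaussian_series[OF square_summable_gram[of j]]
    by (intro integral_cong_AE) auto
  also have "\<dots> = v (i, k) \<bullet> v (j, m)" by (rule isonormal_covariance)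
  finally show ?thesis .
qed

lemma total_trace_gram:
  "total_trace (\<lambda>p q. v p \<bullet> v q) = (\<Sum>k. (\<Sum>i<K. v (i, k)) \<bullet> (\<Sum>i<K. v (i, k)))"
  unfolding total_trace_def by (subst inner_sum_left) (simp add: inner_sum_right)

lemma summable_gram: "summable (\<lambda>k. (\<Sum>i<K. v (i, k)) \<bullet> (\<Sum>i<K. v (i, k)))"
  using square_summable_sum[of "{..<K}" "\<lambda>i k. v (i, k)"] square_summable_gram
  by (simp add: square_summable_def)

end

lemma transport_operator:
  fixes v :: "nat \<times> nat \<Rightarrow> finseq"
  assumes feas: "feasible (\<lambda>p q. v p \<bullet> v q)"
    and max: "\<And>c'. feasible c' \<Longrightarrow> total_trace c' \<le> total_trace (\<lambda>p q. v p \<bullet> v q)"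
    and j: "j < K"
  obtains t :: "'a \<Rightarrow> 'a" where "bounded_linear t" "\<And>u v. t u \<bullet> v = u \<bullet> t v"
    "\<And>u. 0 \<le> t u \<bullet> u" "onorm t \<le> 1"
    "\<And>x. t (hs_op (\<lambda>k. \<Sum>i<K. v (i, k)) x) = hs_op (\<lambda>k. v (j, k)) x"
proof -
  define w r b where "w k = v (j, k)" and "r k = (\<Sum>i\<in>{..<K} - {j}. v (i, k))"
    and "b k = (\<Sum>i<K. v (i, k))" for k
  have b: "b k = w k + r k" for k
    unfolding b_def w_def r_def using j by (simp add: sum.remove[of "{..<K}" j])
  have sw: "square_summable w" unfolding w_def by (rule square_summable_gram[OF feas])
  have sr: "square_summable r"
    unfolding r_def by (rule square_summable_sum) (rule square_summable_gram[OF feas])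
  have sb: "square_summable b"
    unfolding b_def by (rule square_summable_sum) (rule square_summable_gram[OF feas])
  have opt: "(\<Sum>k. (T (w k) - w k) \<bullet> r k) \<le> 0" if T: "\<And>x y. T x \<bullet> T y = x \<bullet> y" for T
  proof -
    define v' where "v' p = (if fst p = j then T (v p) else v p)" for p
    have feas': "feasible (\<lambda>p q. v' p \<bullet> v' q)"
      unfolding feasible_def
    proof (intro conjI allI psd_kernel_gram)
      show "v' (i, k) \<bullet> v' (i, m) = block i k m" for i k m
        using feas T by (simp add: feasible_def v'_def)
    qed
    have b': "(\<Sum>i<K. v' (i, k)) = T (w k) + r k" for k
    proof -
      have "(\<Sum>i<K. v' (i, k)) = v' (j, k) + (\<Sum>i\<in>{..<K} - {j}. v' (i, k))"
        using j by (intro sum.remove) auto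
      also have "(\<Sum>i\<in>{..<K} - {j}. v' (i, k)) = r k"
        unfolding r_def by (rule sum.cong) (auto simp: v'_def)
      finally show ?thesis by (simp add: v'_def w_def)
    qed
    have "(\<Sum>k. (T (w k) + r k) \<bullet> (T (w k) + r k)) \<le> (\<Sum>k. b k \<bullet> b k)"
      using max[OF feas'] unfolding total_trace_gram[OF feas'] total_trace_gram[OF feas] b' b_def .
    moreover have s': "summable (\<lambda>k. (T (w k) + r k) \<bullet> (T (w k) + r k))"
      using summable_gram[OF feas'] by (simp add: b')
    moreover have s: "summable (\<lambda>k. b k \<bullet> b k)" using sb by (simp add: square_summable_def)
    ultimately have "(\<Sum>k. (T (w k) + r k) \<bullet> (T (w k) + r k) - b k \<bullet> b k) \<le> 0"
      by (simp add: suminf_diff[symmetric])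
    moreover have eq: "(T (w k) + r k) \<bullet> (T (w k) + r k) - b k \<bullet> b k = 2 * ((T (w k) - w k) \<bullet> r k)" for k
      using T[of "w k" "w k"] inner_commute[of "r k" "w k"] inner_commute[of "r k" "T (w k)"]
      by (simp add: b inner_add_left inner_add_right inner_diff_left)
    moreover have "summable (\<lambda>k. (T (w k) - w k) \<bullet> r k)"
      using summable_mult[OF summable_diff[OF s' s], of "1/2"] by (simp add: eq)
    ultimately show ?thesis by (simp add: suminf_mult)
  qed
  note opt = optimal_against_isometries[OF _ _ opt]
  have sums: "summable (\<lambda>k. w k \<bullet> w k)" "summable (\<lambda>k. r k \<bullet> r k)"
    using sw sr by (simp_all add: square_summable_def)
  have B: "hs_op b x = hs_op w x + hs_op r x" for x
    by (rule eq_if_coordinates_eq)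
       (simp add: inner_hs_op[OF sb] inner_hs_op[OF sw] inner_hs_op[OF sr] inner_add_right b inner_add_left)
  obtain t where "bounded_linear t" "\<And>u v. t u \<bullet> v = u \<bullet> t v"
    "\<And>u. 0 \<le> t u \<bullet> u" "onorm t \<le> 1" "\<And>x. t (hs_op b x) = hs_op w x"
  proof (rule positive_contraction_factorization[OF linear_hs_op[OF sw] linear_hs_op[OF sb]])
    show "hs_op w x \<bullet> hs_op b y = hs_op w y \<bullet> hs_op b x" for x y
      using opt(2)[OF sums, of x y]
      by (simp add: B inner_add_right inner_hs_op_hs_op[OF sw sr] inner_commute[of "hs_op w x" "hs_op w y"])
    show "hs_op w x \<bullet> hs_op w x \<le> hs_op w x \<bullet> hs_op b x" for x
      using opt(1)[OF sums, of x] by (simp add: B inner_add_right inner_hs_op_hs_op[OF sw sr])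
  qed blast
  then show ?thesis using that unfolding b_def w_def by blast
qed

end

theorem theorem1:
  fixes K :: nat and \<gamma> :: "nat \<Rightarrow> 'a::{real_inner, polish_space} measure"
  assumes "K \<ge> 1"
    and "\<forall>j<K. centred_gaussian (\<gamma> j)"
  shows "\<exists>(t :: nat \<Rightarrow> 'a \<Rightarrow> 'a) (P :: 'a measure) (Z :: 'a \<Rightarrow> 'a).
           (\<forall>j<K. bounded_linear (t j)
                  \<and> (\<forall>u v. inner (t j u) v = inner u (t j v))
                  \<and> (\<forall>u. 0 \<le> inner (t j u) u)
                  \<and> onorm (t j) \<le> real K)
         \<and> prob_space P \<and> Z \<in> measurable P borel
         \<and> optimal_multicoupling K \<gamma>
             (distr P (prodK K) (\<lambda>\<omega>. \<lambda>j\<in>{..<K}. t j (Z \<omega>)))"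
proof -
  obtain e :: "nat \<Rightarrow> 'a" where "hilbert_basis e" by (rule hilbert_basis_exists)
  then interpret gaussian_family e K \<gamma>
    using assms(2) by (auto simp: gaussian_family_def gaussian_family_axioms_def inner_gaussian_def)
  obtain c where c: "feasible c" and c_max: "\<And>c'. feasible c' \<Longrightarrow> total_trace c' \<le> total_trace c"
    using total_trace_maximizer[OF feasible_cov[OF multicoupling_product]] by blast
  obtain v :: "nat \<times> nat \<Rightarrow> finseq" where "\<And>p q. v p \<bullet> v q = c p q"
    using c gram_vectors[of c] by (auto simp: feasible_def)
  then have c_eq: "c = (\<lambda>p q. v p \<bullet> v q)" by (simp add: fun_eq_iff)
  note feas = c[unfolded c_eq] and max = c_max[unfolded c_eq]
  define b where "b k = (\<Sum>i<K. v (i, k))" for k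
  have sb: "square_summable b"
    unfolding b_def by (rule square_summable_sum) (rule square_summable_gram[OF feas])
  have "\<exists>t. j < K \<longrightarrow> bounded_linear t \<and> (\<forall>u v. t u \<bullet> v = u \<bullet> t v) \<and> (\<forall>u. 0 \<le> t u \<bullet> u)
      \<and> onorm t \<le> 1 \<and> (\<forall>x. t (hs_op b x) = hs_op (\<lambda>k. v (j, k)) x)" for j
    using transport_operator[OF feas max, of j] unfolding b_def by metis
  then obtain t where t: "\<And>j. j < K \<Longrightarrow> bounded_linear (t j)"
    "\<And>j u v. j < K \<Longrightarrow> t j u \<bullet> v = u \<bullet> t j v" "\<And>j u. j < K \<Longrightarrow> 0 \<le> t j u \<bullet> u"
    "\<And>j. j < K \<Longrightarrow> onorm (t j) \<le> 1"
    "\<And>j x. j < K \<Longrightarrow> t j (hs_op b x) = hs_op (\<lambda>k. v (j, k)) x"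
    by metis
  define P where "P = distr white_noise borel (gaussian_series b)"
  have t_measurable: "t j \<in> borel_measurable borel" if "j < K" for j
    using t(1)[OF that] by (intro borel_measurable_continuous_onI linear_continuous_on)
  have t_prod: "(\<lambda>x. \<lambda>j\<in>{..<K}. t j x) \<in> measurable borel (prodK K)"
    unfolding prodK_def by (rule measurable_restrict) (simp add: t_measurable)
  have "AE \<omega> in white_noise. t j (gaussian_series b \<omega>) = gaussian_series (\<lambda>k. v (j, k)) \<omega>" if "j < K" for j
    using that t(2,5) by (intro gaussian_series_operator square_summable_gram[OF feas] sb) auto
  then have "AE \<omega> in white_noise. \<forall>j\<in>{..<K}. t j (gaussian_series b \<omega>) = gaussian_series (\<lambda>k. v (j, k)) \<omega>"
    by (intro AE_finite_allI) auto
  then have AE: "AE \<omega> in white_noise. (\<lambda>j\<in>{..<K}. t j (gaussian_series b \<omega>))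
      = (\<lambda>j\<in>{..<K}. gaussian_series (\<lambda>k. v (j, k)) \<omega>)"
    by eventually_elim (auto simp: restrict_def)
  have "distr P (prodK K) (\<lambda>x. \<lambda>j\<in>{..<K}. t j x)
      = distr white_noise (prodK K) (\<lambda>\<omega>. \<lambda>j\<in>{..<K}. t j (gaussian_series b \<omega>))"
    unfolding P_def by (simp add: distr_distr[OF t_prod] comp_def)
  also have "\<dots> = series_law v"
    unfolding series_law_def[OF feas]
    using AE measurable_series[OF feas] measurable_compose[OF measurable_gaussian_series t_prod]
    by (intro distr_cong_AE) auto
  finally have law: "distr P (prodK K) (\<lambda>x. \<lambda>j\<in>{..<K}. t j x) = series_law v" .
  have "total_trace (cov (series_law v)) = total_trace c"
    unfolding total_trace_def c_eq by (simp add: cov_series_law[OF feas])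
  then have "mc_cost K (series_law v) \<le> mc_cost K \<pi>'" if "multicoupling K \<gamma> \<pi>'" for \<pi>'
    unfolding mc_cost_eq[OF that] mc_cost_eq[OF multicoupling_series_law[OF feas]]
    using c_max[OF feasible_cov[OF that]] by (intro ennreal_leI mult_left_mono) auto
  then have "optimal_multicoupling K \<gamma> (series_law v)"
    using multicoupling_series_law[OF feas] by (simp add: optimal_multicoupling_def)
  moreover have "prob_space P"
    unfolding P_def by (rule white_noise.prob_space_distr) simp
  moreover have "(\<lambda>x. x) \<in> measurable P borel" by (simp add: P_def)
  moreover have "onorm (t j) \<le> real K" if "j < K" for j
    using t(4)[OF that] assms(1) by linarith
  ultimately show ?thesis
    using t(1-3) law by (intro exI[of _ t] exI[of _ P] exI[of _ "\<lambda>x. x"]) auto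
qed

end
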